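(* Let $G$ be a locally compact group with left Haar measure $m$, and let $1<q<\infty$. Suppose that $G$ is $(1,q)$-amenable. Then for every $\varepsilon>0$ there exists $n_0=n_0(\varepsilon)\in\mathbb N$ such that, for all $n\ge n_0$ and every subset $F\subset G$ with exactly $n$ elements, there exists a compact subset $S\subset G$ with $m(S)>0$ and $$\frac{m(FS)}{m(S)}\le\varepsilon n.$$
   Context: $L^1(G)=L^1(G,m)$, and $FS=\{fs:f\in F,\ s\in S\}$. (A discrete group with the property in the conclusion is called pseudo-amenable.) Weak $(p,q)$-multi-norm. For a Banach space $X$, $1\le p<\infty$ and $x=(x_1,\dots,x_n)\in X^n$, put $\mu_{p,n}(x)=\sup\{(\sum_{i=1}^n|\langle x_i,\lambda\rangle|^p)^{1/p}:\lambda\in X',\ \|\lambda\|\le1\}$. For $1\le p\le q<\infty$ and $x\in X^n$, put $$\|x\|_n^{(p,q)}=\sup\Big\{\Big(\sum_{i=1}^n|\langle x_i,\lambda_i\rangle|^q\Big)^{1/q}:\lambda=(\lambda_1,\dots,\lambda_n)\in (X')^n,\ \mu_{p,n}(\lambda)\le1\Big\}.$$ $(p,q)$-amenability. For $f\in L^1(G)$, $s\in G$, let $(s\cdot f)(t)=f(s^{-1}t)$; this action of $G$ is extended to $L^1(G)''$ by taking second adjoints. A mean is an element $\Lambda\in L^1(G)''$ with $\langle 1,\Lambda\rangle=\|\Lambda\|=1$, where $1\in L^\infty(G)$ is the constant function. For $1\le p\le q<\infty$, $G$ is $(p,q)$-amenable if there is a mean $\Lambda$ which is left $(p,q)$-multi-invariant,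 i.e. $\sup\{\|(s_1\cdot\Lambda,\dots,s_n\cdot\Lambda)\|_n^{(p,q)}:s_1,\dots,s_n\in G,\ n\in\mathbb N\}<\infty$, where the weak $(p,q)$-multi-norm is taken over the Banach space $X=L^1(G)''$. *)

theory Defs
  imports "HOL-Analysis.Analysis"
begin

text \<open>
  Groups are types of class \<open>topological_group_add\<close>, which does not assume commutativity.  The group
  law is therefore written \<open>+\<close>: \<open>s t\<close> becomes \<open>s + t\<close> and the inverse of \<open>s\<close> becomes \<open>- s\<close>.
\<close>

definition left_haar_measure :: "'g::{topological_group_add,t2_space} measure \<Rightarrow> bool" where
  "left_haar_measure m \<longleftrightarrow>
     sets m = sets borel \<and>
     emeasure m UNIV \<noteq> 0 \<and>
     (\<forall>K. compact K \<longrightarrow> emeasure m K < \<infinity>) \<and>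
     (\<forall>A\<in>sets borel. emeasure m A = (INF U\<in>{U. open U \<and> A \<subseteq> U}. emeasure m U)) \<and>
     (\<forall>U. open U \<longrightarrow> emeasure m U = (SUP K\<in>{K. compact K \<and> K \<subseteq> U}. emeasure m K)) \<and>
     (\<forall>s. \<forall>A\<in>sets borel. emeasure m ((\<lambda>t. s + t) ` A) = emeasure m A)"

text \<open>
  A complex normed space is given by a set of complex-valued functions, closed under the pointwise
  vector space operations, and a norm on it.  The duals of such a space are again of this form.  The
  norm may be a seminorm: this allows \<open>L\<^sup>1\<close> to be represented by functions instead of classes modulo
  null functions, since a functional bounded with respect to a seminorm depends only on the class of
  its argument, so that the dual is that of the quotient.
\<close>

record 'i fun_space =
  vecs :: "('i \<Rightarrow> complex) set"
  nrm :: "('i \<Rightarrow> complex) \<Rightarrow> real"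

text \<open>
  Functionals are set to 0 outside the space, so that equality of functionals is equality of functions
  and the dual is closed under the pointwise operations.
\<close>

definition dual :: "'i fun_space \<Rightarrow> ('i \<Rightarrow> complex) fun_space" where
  "dual X = \<lparr>
     vecs = {\<phi>. (\<forall>x. x \<notin> vecs X \<longrightarrow> \<phi> x = 0) \<and>
                (\<forall>x\<in>vecs X. \<forall>y\<in>vecs X. \<forall>a b. \<phi> (\<lambda>i. a * x i + b * y i) = a * \<phi> x + b * \<phi> y) \<and>
                (\<exists>C. \<forall>x\<in>vecs X. cmod (\<phi> x) \<le> C * nrm X x)},
     nrm = (\<lambda>\<phi>. SUP x\<in>{x\<in>vecs X. nrm X x \<le> 1}. cmod (\<phi> x)) \<rparr>"

text \<open>The adjoint of an operator \<open>T\<close> with domain \<open>X\<close>.\<close>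

definition adjoint_op ::
  "'i fun_space \<Rightarrow> (('i \<Rightarrow> complex) \<Rightarrow> ('j \<Rightarrow> complex)) \<Rightarrow> (('j \<Rightarrow> complex) \<Rightarrow> complex) \<Rightarrow> ('i \<Rightarrow> complex) \<Rightarrow> complex"
  where "adjoint_op X T \<phi> = (\<lambda>x. if x \<in> vecs X then \<phi> (T x) else 0)"

text \<open>
  Tuples \<open>(x\<^sub>1, \<dots>, x\<^sub>n)\<close> are functions on \<open>nat\<close> of which only the values at \<open>i < n\<close> matter.
  Suprema are taken in \<open>ennreal\<close>, where they exist unconditionally.
\<close>

definition weak_summing_norm ::
  "real \<Rightarrow> 'i fun_space \<Rightarrow> nat \<Rightarrow> (nat \<Rightarrow> 'i \<Rightarrow> complex) \<Rightarrow> ennreal" where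
  "weak_summing_norm p X n x =
     (SUP \<phi>\<in>{\<phi>\<in>vecs (dual X). nrm (dual X) \<phi> \<le> 1}.
        ennreal ((\<Sum>i<n. cmod (\<phi> (x i)) powr p) powr (1 / p)))"

definition weak_multi_norm ::
  "real \<Rightarrow> real \<Rightarrow> 'i fun_space \<Rightarrow> nat \<Rightarrow> (nat \<Rightarrow> 'i \<Rightarrow> complex) \<Rightarrow> ennreal" where
  "weak_multi_norm p q X n x =
     (SUP \<phi>\<in>{\<phi>. (\<forall>i<n. \<phi> i \<in> vecs (dual X)) \<and> weak_summing_norm p (dual X) n \<phi> \<le> 1}.
        ennreal ((\<Sum>i<n. cmod (\<phi> i (x i)) powr q) powr (1 / q)))"

definition L1 :: "'g measure \<Rightarrow> 'g fun_space" where
  "L1 m = \<lparr> vecs = {f. integrable m f}, nrm = (\<lambda>f. \<integral>t. cmod (f t) \<partial>m) \<rparr>"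

lemma dual_L1_cong_AE:
  assumes \<phi>: "\<phi> \<in> vecs (dual (L1 m))" and f: "integrable m f" and g: "integrable m g"
    and ae: "AE t in m. f t = g t"
  shows "\<phi> f = \<phi> g"
proof -
  from \<phi> obtain C where lin: "\<And>a b. \<phi> (\<lambda>t. a * f t + b * g t) = a * \<phi> f + b * \<phi> g"
    and C: "\<And>h. integrable m h \<Longrightarrow> cmod (\<phi> h) \<le> C * (\<integral>t. cmod (h t) \<partial>m)"
    using f g by (auto simp: dual_def L1_def)
  have int: "integrable m (\<lambda>t. 1 * f t + (-1) * g t)"
    using f g by simp
  have "AE t in m. cmod (1 * f t + (-1) * g t) = 0"
    using ae by eventually_elim simp
  hence "(\<integral>t. cmod (1 * f t + (-1) * g t) \<partial>m) = 0"
    by (rule integral_eq_zero_AE)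
  with C[OF int] have "\<phi> (\<lambda>t. 1 * f t + (-1) * g t) = 0"
    by simp
  with lin[of 1 "-1"] show ?thesis
    by simp
qed

text \<open>The functional on \<open>L\<^sup>1\<close> given by integration against a bounded measurable \<open>h\<close>.\<close>

definition Linf_functional :: "'g measure \<Rightarrow> ('g \<Rightarrow> complex) \<Rightarrow> ('g \<Rightarrow> complex) \<Rightarrow> complex" where
  "Linf_functional m h = (\<lambda>f. if f \<in> vecs (L1 m) then \<integral>t. f t * h t \<partial>m else 0)"

definition translate :: "'g::group_add \<Rightarrow> ('g \<Rightarrow> complex) \<Rightarrow> 'g \<Rightarrow> complex" where
  "translate s f = (\<lambda>t. f (- s + t))"

definition bidual_action ::
  "'g::group_add measure \<Rightarrow> 'g \<Rightarrow> ((('g \<Rightarrow> complex) \<Rightarrow> complex) \<Rightarrow> complex) \<Rightarrow> (('g \<Rightarrow> complex) \<Rightarrow> complex) \<Rightarrow> complex"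
  where "bidual_action m s = adjoint_op (dual (L1 m)) (adjoint_op (L1 m) (translate s))"

definition mean :: "'g measure \<Rightarrow> ((('g \<Rightarrow> complex) \<Rightarrow> complex) \<Rightarrow> complex) \<Rightarrow> bool" where
  "mean m \<Lambda> \<longleftrightarrow>
     \<Lambda> \<in> vecs (dual (dual (L1 m))) \<and>
     \<Lambda> (Linf_functional m (\<lambda>t. 1)) = 1 \<and>
     nrm (dual (dual (L1 m))) \<Lambda> = 1"

definition left_multi_invariant ::
  "real \<Rightarrow> real \<Rightarrow> 'g::group_add measure \<Rightarrow> ((('g \<Rightarrow> complex) \<Rightarrow> complex) \<Rightarrow> complex) \<Rightarrow> bool" where
  "left_multi_invariant p q m \<Lambda> \<longleftrightarrow>
     (SUP n. SUP s :: nat \<Rightarrow> 'g.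
        weak_multi_norm p q (dual (dual (L1 m))) n (\<lambda>i. bidual_action m (s i) \<Lambda>)) < \<infinity>"

text \<open>The group is the type \<open>'g\<close>; \<open>m\<close> is its Haar measure.  Meaningful for \<open>1 \<le> p \<le> q < \<infinity>\<close>.\<close>

definition pq_amenable :: "real \<Rightarrow> real \<Rightarrow> 'g::group_add measure \<Rightarrow> bool" where
  "pq_amenable p q m \<longleftrightarrow> (\<exists>\<Lambda>. mean m \<Lambda> \<and> left_multi_invariant p q m \<Lambda>)"

end

theory Submission
  imports Defs "HOL-Library.Function_Algebras"
begin

text \<open>
  Suppose that \<open>\<integral> max\<^sub>i (s\<^sub>i f) \<ge> K \<integral> f\<close> for all \<open>f \<ge> 0\<close> in \<open>L\<^sup>1\<close>, where \<open>F = {s\<^sub>i}\<close>.  The Hahn--Banach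
  theorem on \<open>n\<close>-tuples of functions gives positive functionals \<open>\<lambda>\<^sub>i\<close> on \<open>L\<^sup>1\<close> with
  \<open>\<Sum> \<lambda>\<^sub>i(g\<^sub>i) \<le> \<integral> max\<^sub>i g\<^sub>i\<^sup>+\<close>, which makes their weak 1-summing norm at most 1, and with
  \<open>\<Sum> \<lambda>\<^sub>i(s\<^sub>i f) \<ge> K \<integral> f\<close>.  For an invariant mean \<open>\<Lambda>\<close> with constant \<open>C\<close> the first property gives
  \<open>\<Sum> |\<langle>s\<^sub>i \<Lambda>, \<lambda>\<^sub>i\<rangle>|\<^sup>q \<le> C\<^sup>q\<close> and the second, by positivity of \<open>\<Lambda>\<close>, gives \<open>\<Sum> \<langle>s\<^sub>i \<Lambda>, \<lambda>\<^sub>i\<rangle> \<ge> K\<close>; for \<open>K\<close> a small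
  multiple of a large \<open>n\<close> this is impossible.  So some \<open>f \<ge> 0\<close> has \<open>\<integral> max\<^sub>i (s\<^sub>i f) < K \<integral> f\<close>.  As
  \<open>{max\<^sub>i (s\<^sub>i f) > c} = F {f > c}\<close>, comparing level sets yields a set \<open>A = {f > c}\<close> with
  \<open>m(F A) \<le> K m(A)\<close>, and \<open>S\<close> is a compact subset of \<open>A\<close> of at least half its measure.
\<close>

section \<open>The Hahn--Banach theorem\<close>

text \<open>The scalar multiplication is a parameter because the theorem is applied to tuples of
  real functions with pointwise operations. Everything is relative to a subspace \<open>V\<close>,
  there the integrable tuples.\<close>

locale real_linear_space = vector_space scale
  for scale :: "real \<Rightarrow> 'b::ab_group_add \<Rightarrow> 'b" (infixr \<open>*r\<close> 75)
begin

definition sublinear_on :: "'b set \<Rightarrow> ('b \<Rightarrow> real) \<Rightarrow> bool" where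
  "sublinear_on V p \<longleftrightarrow>
     (\<forall>x\<in>V. \<forall>y\<in>V. p (x + y) \<le> p x + p y) \<and> (\<forall>x\<in>V. \<forall>a\<ge>0. p (a *r x) = a * p x)"

lemma sublinear_on_add: "sublinear_on V p \<Longrightarrow> x \<in> V \<Longrightarrow> y \<in> V \<Longrightarrow> p (x + y) \<le> p x + p y"
  and sublinear_on_scale: "sublinear_on V p \<Longrightarrow> x \<in> V \<Longrightarrow> 0 \<le> a \<Longrightarrow> p (a *r x) = a * p x"
  by (auto simp: sublinear_on_def)

lemma sublinear_on_zero: "subspace V \<Longrightarrow> sublinear_on V p \<Longrightarrow> p 0 = 0"
  using sublinear_on_scale[of V p 0 0] subspace_0[of V] by simp

lemma sublinear_on_uminus_ge:
  assumes "subspace V" "sublinear_on V p" "x \<in> V"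
  shows "- p (- x) \<le> p x"
  using sublinear_on_add[OF assms(2,3) subspace_neg[OF assms(1,3)]] sublinear_on_zero[OF assms(1,2)]
  by simp

text \<open>The largest sublinear functional below \<open>p\<close> whose linear minorants are at least \<open>c\<close> on \<open>D\<close>.\<close>

lemma sublinear_on_lowering:
  assumes V: "subspace V" and p: "sublinear_on V p"
    and D: "D \<subseteq> V" "0 \<in> D" "\<forall>x\<in>D. \<forall>y\<in>D. x + y \<in> D" "\<forall>x\<in>D. \<forall>a\<ge>0. a *r x \<in> D"
    and c: "\<forall>x\<in>D. \<forall>y\<in>D. c (x + y) = c x + c y" "\<forall>x\<in>D. \<forall>a\<ge>0. c (a *r x) = a * c x"
    and cp: "\<forall>x\<in>D. c x \<le> p x"
  defines "r \<equiv> \<lambda>x. if x \<in> V then INF k\<in>D. p (x + k) - c k else 0"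
  shows "sublinear_on V r" "\<forall>x\<in>V. r x \<le> p x" "\<And>k. k \<in> D \<Longrightarrow> r (- k) \<le> - c k"
proof -
  have c0: "c 0 = 0" using c(2) D(2) by force
  \<comment> \<open>From \<open>c k \<le> p k\<close> and \<open>k = (x + k) + (- x)\<close>. The
    bound does not depend on \<open>k\<close>, so the infimum defining \<open>r\<close> is over a
    set bounded below.\<close>
  have low: "- p (- x) \<le> p (x + k) - c k" if "x \<in> V" "k \<in> D" for x k
  proof -
    have "p ((x + k) + (- x)) \<le> p (x + k) + p (- x)"
      using that D(1) V by (intro sublinear_on_add[OF p] subspace_add subspace_neg) auto
    thus ?thesis using cp that(2) by force
  qed
  have bdd: "bdd_below ((\<lambda>k. p (x + k) - c k) ` D)" if "x \<in> V" for x
    using low[OF that] by (auto intro!: bdd_belowI[of _ "- p (- x)"])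
  have le: "r x \<le> p (x + k) - c k" if "x \<in> V" "k \<in> D" for x k
    using that by (auto simp: r_def intro!: cINF_lower bdd)
  have ge: "b \<le> r x" if "x \<in> V" "\<And>k. k \<in> D \<Longrightarrow> b \<le> p (x + k) - c k" for x b
    using that D(2) by (auto simp: r_def intro!: cINF_greatest)
  show "\<forall>x\<in>V. r x \<le> p x" using le[OF _ D(2)] c0 by simp
  show "r (- k) \<le> - c k" if "k \<in> D" for k
  proof -
    have "- k \<in> V" using that D(1) V subspace_neg by blast
    from le[OF this that] show ?thesis using sublinear_on_zero[OF V p] by simp
  qed
  have r0: "r 0 = 0"
  proof (rule antisym)
    show "r 0 \<le> 0" using le[OF subspace_0[OF V] D(2)] c0 sublinear_on_zero[OF V p] by simp
    show "0 \<le> r 0" using cp by (intro ge subspace_0[OF V]) simp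
  qed
  show "sublinear_on V r"
    unfolding sublinear_on_def
  proof (intro conjI ballI allI impI)
    fix x y assume xy: "x \<in> V" "y \<in> V"
    \<comment> \<open>As \<open>k + l\<close> lies in \<open>D\<close> and \<open>c\<close> is
      additive, one competitor for \<open>x + y\<close> splits into competitors for \<open>x\<close>
      and for \<open>y\<close>. The infima over \<open>l\<close> and over \<open>k\<close> are then
      taken one after the other.\<close>
    have "r (x + y) - (p (x + k) - c k) \<le> p (y + l) - c l" if "k \<in> D" "l \<in> D" for k l
    proof -
      have "r (x + y) \<le> p ((x + y) + (k + l)) - c (k + l)"
        using xy that V D(3) by (intro le) (auto intro: subspace_add)
      also have "(x + y) + (k + l) = (x + k) + (y + l)" by (simp add: algebra_simps)
      also have "p \<dots> \<le> p (x + k) + p (y + l)"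
        using xy that V D(1) by (intro sublinear_on_add[OF p] subspace_add) auto
      finally show ?thesis using c(1) that by simp
    qed
    hence "r (x + y) - (p (x + k) - c k) \<le> r y" if "k \<in> D" for k
      using that xy by (intro ge) auto
    hence "r (x + y) - r y \<le> p (x + k) - c k" if "k \<in> D" for k
      using that by (simp add: algebra_simps)
    hence "r (x + y) - r y \<le> r x" using xy by (intro ge) auto
    thus "r (x + y) \<le> r x + r y" by simp
  next
    fix x and a :: real assume x: "x \<in> V" and a: "0 \<le> a"
    \<comment> \<open>Replacing \<open>k\<close> by \<open>b *r k\<close> in the infimum gives one
      inequality; the same inequality for the inverse scalar gives the other.\<close>
    have up: "r (b *r z) \<le> b * r z" if b: "0 < b" and z: "z \<in> V" for b z
    proof -
      have "r (b *r z) / b \<le> p (z + k) - c k" if "k \<in> D" for k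
      proof -
        have "r (b *r z) \<le> p (b *r z + b *r k) - c (b *r k)"
          using b z that V D(4) by (intro le) (auto intro: subspace_scale)
        also have "b *r z + b *r k = b *r (z + k)" by (simp add: scale_right_distrib)
        also have "p \<dots> = b * p (z + k)"
          using b z that V D(1) by (intro sublinear_on_scale[OF p] subspace_add) auto
        finally have "r (b *r z) \<le> b * (p (z + k) - c k)"
          using b c(2) that by (simp add: right_diff_distrib)
        thus ?thesis using b by (simp add: divide_le_eq mult.commute)
      qed
      hence "r (b *r z) / b \<le> r z" using z by (intro ge) auto
      thus ?thesis using b by (simp add: divide_le_eq mult.commute)
    qed
    show "r (a *r x) = a * r x"
    proof (cases "a = 0")
      case False
      hence a: "0 < a" using a by simp
      have "r (inverse a *r (a *r x)) \<le> inverse a * r (a *r x)"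
        using a x V by (intro up subspace_scale) auto
      moreover have "inverse a *r (a *r x) = x" using a by simp
      ultimately have "r x \<le> inverse a * r (a *r x)" by simp
      hence "a * r x \<le> r (a *r x)"
        using a by (simp add: inverse_eq_divide pos_le_divide_eq mult.commute)
      with up[OF a x] show ?thesis by simp
    qed (simp add: r0)
  qed
qed

text \<open>Zorn's lemma for the pointwise order. The infimum of a chain exists since all members
  are bounded below by \<open>- p (- x)\<close>, and it inherits sublinearity because a chain is
  directed downwards.\<close>

lemma minimal_sublinear_exists:
  assumes V: "subspace V" and p: "sublinear_on V p"
  obtains l where "sublinear_on V l" "\<And>x. x \<in> V \<Longrightarrow> l x \<le> p x"
    "\<And>r x. sublinear_on V r \<Longrightarrow> \<forall>x\<in>V. r x \<le> l x \<Longrightarrow> x \<in> V \<Longrightarrow> r x = l x"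
proof -
  \<comment> \<open>Members are fixed to be 0 off \<open>V\<close>, so that comparing them at all
    points, as \<open>P\<close> does, amounts to comparing them on \<open>V\<close>.\<close>
  define A where "A = {r. sublinear_on V r \<and> (\<forall>x\<in>V. r x \<le> p x) \<and> (\<forall>x. x \<notin> V \<longrightarrow> r x = 0)}"
  \<comment> \<open>\<open>P a b\<close> means that \<open>b\<close> lies below \<open>a\<close>: a
    maximal element for \<open>P\<close> is a minimal functional, and the infimum of a chain serves
    as its upper bound.\<close>
  define P where "P = (\<lambda>a b :: 'b \<Rightarrow> real. \<forall>x. b x \<le> a x)"
  have "partial_order_on A (relation_of P A)"
    by (rule partial_order_on_relation_ofI) (auto simp: P_def fun_eq_iff intro: order_trans antisym)
  moreover have "\<exists>u\<in>A. \<forall>a\<in>C. P a u" if C: "C \<in> Chains (relation_of P A)" for C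
  proof (cases "C = {}")
    case True
    define p' where "p' = (\<lambda>x. if x \<in> V then p x else 0)"
    have "p' \<in> A"
      using p V by (auto simp: A_def p'_def sublinear_on_def subspace_add subspace_scale)
    with True show ?thesis by auto
  next
    case False
    have CA: "C \<subseteq> A" and chain: "\<And>a b. a \<in> C \<Longrightarrow> b \<in> C \<Longrightarrow> P a b \<or> P b a"
      using C by (auto simp: Chains_def relation_of_def)
    have sub: "sublinear_on V a" and ap: "x \<in> V \<Longrightarrow> a x \<le> p x" and a0: "x \<notin> V \<Longrightarrow> a x = 0"
      if "a \<in> C" for a x
      using that CA by (auto simp: A_def)
    have low: "- p (- x) \<le> a x" if "x \<in> V" "a \<in> C" for x a
    proof -
      have "- a (- x) \<le> a x" using sublinear_on_uminus_ge[OF V sub[OF that(2)] that(1)] .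
      moreover have "a (- x) \<le> p (- x)" using that V by (intro ap subspace_neg)
      ultimately show ?thesis by linarith
    qed
    define u where "u = (\<lambda>x. if x \<in> V then INF a\<in>C. a x else 0)"
    have le: "u x \<le> a x" if "a \<in> C" for a x
    proof (cases "x \<in> V")
      case True
      have "bdd_below ((\<lambda>a. a x) ` C)"
        using low[OF True] by (auto intro!: bdd_belowI[of _ "- p (- x)"])
      thus ?thesis using True that by (auto simp: u_def intro: cINF_lower)
    qed (simp add: u_def a0[OF that])
    have ge: "b \<le> u x" if "x \<in> V" "\<And>a. a \<in> C \<Longrightarrow> b \<le> a x" for x b
      using that False by (auto simp: u_def intro: cINF_greatest)
    have "sublinear_on V u"
      unfolding sublinear_on_def
    proof (intro conjI ballI allI impI)
      fix x y assume xy: "x \<in> V" "y \<in> V"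
      have "u (x + y) \<le> a x + b y" if ab: "a \<in> C" "b \<in> C" for a b
      proof -
        \<comment> \<open>The smaller of two members of a chain is below both, so subadditivity of a
          single functional suffices.\<close>
        obtain d where d: "d \<in> C" "d x \<le> a x" "d y \<le> b y"
          using chain[OF ab] ab unfolding P_def by blast
        have "u (x + y) \<le> d (x + y)" using d le by auto
        also have "\<dots> \<le> d x + d y" using sublinear_on_add[OF sub[OF d(1)] xy] .
        finally show ?thesis using d by linarith
      qed
      hence "u (x + y) - a x \<le> b y" if "a \<in> C" "b \<in> C" for a b
        using that by (simp add: algebra_simps)
      hence "u (x + y) - a x \<le> u y" if "a \<in> C" for a
        using that xy by (intro ge) auto
      hence "u (x + y) - u y \<le> u x" using xy by (intro ge) (auto simp: algebra_simps)
      thus "u (x + y) \<le> u x + u y" by simp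
    next
      fix x and a :: real assume x: "x \<in> V" and a: "0 \<le> a"
      show "u (a *r x) = a * u x"
      proof (cases "a = 0")
        case True
        have "u 0 = 0"
        proof (rule antisym)
          obtain b where b: "b \<in> C" using False by blast
          show "u 0 \<le> 0" using le[OF b, of 0] sublinear_on_zero[OF V sub[OF b]] by simp
          show "0 \<le> u 0" by (intro ge subspace_0[OF V]) (simp add: sublinear_on_zero[OF V sub])
        qed
        with True show ?thesis by simp
      next
        case nz: False
        have ax: "a *r x \<in> V" using V x by (rule subspace_scale)
        have "a * u x \<le> u (a *r x)"
        proof (intro ge ax)
          fix b assume b: "b \<in> C"
          show "a * u x \<le> b (a *r x)"
            using le[OF b, of x] sublinear_on_scale[OF sub[OF b] x a] a by (simp add: mult_left_mono)
        qed
        moreover have "u (a *r x) / a \<le> u x"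
        proof (intro ge x)
          fix b assume b: "b \<in> C"
          have "u (a *r x) \<le> a * b x" using le[OF b, of "a *r x"] sublinear_on_scale[OF sub[OF b] x a] by simp
          thus "u (a *r x) / a \<le> b x" using a nz by (simp add: field_simps)
        qed
        ultimately show ?thesis using a nz by (simp add: field_simps)
      qed
    qed
    moreover have "u x \<le> p x" if "x \<in> V" for x
    proof -
      obtain a where a: "a \<in> C" using False by blast
      show ?thesis using le[OF a] ap[OF a that] by (rule order_trans)
    qed
    ultimately have "u \<in> A" by (simp add: A_def u_def)
    with le show ?thesis by (auto simp: P_def)
  qed
  ultimately obtain l where l: "l \<in> A" and min: "\<And>a. a \<in> A \<Longrightarrow> P l a \<Longrightarrow> a = l"
    using predicate_Zorn[of A P] by blast
  show thesis
  proof (rule that[of l])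
    fix r x assume r: "sublinear_on V r" "\<forall>x\<in>V. r x \<le> l x" and x: "x \<in> V"
    define r' where "r' = (\<lambda>x. if x \<in> V then r x else 0)"
    have "sublinear_on V r'"
      using r(1) V by (auto simp: r'_def sublinear_on_def subspace_add subspace_scale)
    moreover have "r' x \<le> p x" if "x \<in> V" for x
      using bspec[OF r(2) that] l that unfolding A_def r'_def by force
    ultimately have "r' \<in> A" by (simp add: A_def r'_def)
    moreover have "P l r'" using r(2) l by (simp add: P_def A_def r'_def)
    ultimately have "r' = l" by (rule min)
    thus "r x = l x" using x by (auto simp: r'_def)
  qed (use l in \<open>auto simp: A_def\<close>)
qed

lemma hahn_banach_minorant:
  assumes V: "subspace V" and p: "sublinear_on V p"
  obtains l where "\<And>x y. x \<in> V \<Longrightarrow> y \<in> V \<Longrightarrow> l (x + y) = l x + l y"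
    "\<And>a x. x \<in> V \<Longrightarrow> l (a *r x) = a * l x" "\<And>x. x \<in> V \<Longrightarrow> l x \<le> p x"
proof -
  obtain l where l: "sublinear_on V l" "\<And>x. x \<in> V \<Longrightarrow> l x \<le> p x"
    and min: "\<And>r x. sublinear_on V r \<Longrightarrow> \<forall>x\<in>V. r x \<le> l x \<Longrightarrow> x \<in> V \<Longrightarrow> r x = l x"
    using minimal_sublinear_exists[OF V p] by blast
  \<comment> \<open>A minimal sublinear functional is unchanged by lowering along the ray through \<open>y\<close>; hence it is odd.\<close>
  have odd: "l (- y) = - l y" if y: "y \<in> V" for y
  proof -
    define D where "D = (\<lambda>t. t *r y) ` {0..}"
    have D: "D \<subseteq> V" "0 \<in> D" "\<forall>x\<in>D. \<forall>z\<in>D. x + z \<in> D"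
      "\<forall>x\<in>D. \<forall>a\<ge>0. a *r x \<in> D"
    proof -
      show "D \<subseteq> V" using V y by (auto simp: D_def subspace_scale)
      show "0 \<in> D" unfolding D_def by (rule image_eqI[of _ _ 0]) auto
      show "\<forall>x\<in>D. \<forall>z\<in>D. x + z \<in> D"
        by (auto simp: D_def simp flip: scale_left_distrib)
      show "\<forall>x\<in>D. \<forall>a\<ge>0. a *r x \<in> D"
        by (auto simp: D_def)
    qed
    have add: "\<forall>x\<in>D. \<forall>z\<in>D. l (x + z) = l x + l z"
      using y sublinear_on_scale[OF l(1)]
      by (auto simp: D_def distrib_right simp flip: scale_left_distrib)
    have sc: "\<forall>x\<in>D. \<forall>a\<ge>0. l (a *r x) = a * l x"
      using D(1) sublinear_on_scale[OF l(1)] by auto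
    note low = sublinear_on_lowering[OF V l(1) D add sc ballI[OF order_refl]]
    have yD: "y \<in> D" unfolding D_def by (rule image_eqI[of _ _ 1]) auto
    have "l (- y) \<le> - l y" using low(3)[OF yD] unfolding min[OF low(1,2) subspace_neg[OF V y]] .
    thus ?thesis using sublinear_on_uminus_ge[OF V l(1) y] by linarith
  qed
  have "l (x + y) = l x + l y" if xy: "x \<in> V" "y \<in> V" for x y
  proof (rule antisym)
    \<comment> \<open>Subadditivity at \<open>- x\<close> and \<open>- y\<close>, read through
      oddness, is superadditivity at \<open>x\<close> and \<open>y\<close>.\<close>
    have eq: "- (x + y) = - x + - y" by simp
    have "l (- (x + y)) \<le> l (- x) + l (- y)"
      unfolding eq using xy V by (intro sublinear_on_add[OF l(1)] subspace_neg)
    thus "l x + l y \<le> l (x + y)"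
      using odd[OF xy(1)] odd[OF xy(2)] odd[OF subspace_add[OF V xy]] by linarith
  qed (use xy l in \<open>auto intro: sublinear_on_add\<close>)
  moreover have "l (a *r x) = a * l x" if x: "x \<in> V" for a x
  proof (cases "0 \<le> a")
    case False
    have "l (- ((- a) *r x)) = - l ((- a) *r x)" using V x by (intro odd subspace_scale)
    also have "l ((- a) *r x) = (- a) * l x" using False x by (intro sublinear_on_scale[OF l(1)]) auto
    finally show ?thesis by simp
  qed (use x in \<open>auto intro: sublinear_on_scale[OF l(1)]\<close>)
  ultimately show thesis using that l(2) by blast
qed

text \<open>Take a linear minorant \<open>l\<close> of the functional lowered along the cone
  \<open>D\<close>. The lowered functional is at most \<open>- c x\<close> at \<open>- x\<close>,
  which by linearity of \<open>l\<close> becomes \<open>c x \<le> l x\<close>.\<close>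

lemma hahn_banach_sandwich:
  assumes V: "subspace V" and p: "sublinear_on V p"
    and D: "D \<subseteq> V" "0 \<in> D" "\<forall>x\<in>D. \<forall>y\<in>D. x + y \<in> D" "\<forall>x\<in>D. \<forall>a\<ge>0. a *r x \<in> D"
    and c: "\<forall>x\<in>D. \<forall>y\<in>D. c (x + y) = c x + c y" "\<forall>x\<in>D. \<forall>a\<ge>0. c (a *r x) = a * c x"
    and cp: "\<forall>x\<in>D. c x \<le> p x"
  obtains l where "\<And>x y. x \<in> V \<Longrightarrow> y \<in> V \<Longrightarrow> l (x + y) = l x + l y"
    "\<And>a x. x \<in> V \<Longrightarrow> l (a *r x) = a * l x" "\<And>x. x \<in> V \<Longrightarrow> l x \<le> p x"
    "\<And>x. x \<in> D \<Longrightarrow> c x \<le> l x"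
proof -
  note low = sublinear_on_lowering[OF V p D c cp]
  obtain l where add: "\<And>x y. x \<in> V \<Longrightarrow> y \<in> V \<Longrightarrow> l (x + y) = l x + l y"
    and scale: "\<And>a x. x \<in> V \<Longrightarrow> l (a *r x) = a * l x"
    and le: "\<And>x. x \<in> V \<Longrightarrow> l x \<le> (if x \<in> V then INF k\<in>D. p (x + k) - c k else 0)"
    using hahn_banach_minorant[OF V low(1)] by blast
  have "c x \<le> l x" if x: "x \<in> D" for x
  proof -
    have "l (- x) \<le> - c x" using le[of "- x"] low(3)[OF x] D(1) x V subspace_neg by force
    moreover have "l (- x) = - l x" using scale[of x "-1"] D(1) x by auto
    ultimately show ?thesis by linarith
  qed
  moreover have "l x \<le> p x" if "x \<in> V" for x
    using le[OF that] bspec[OF low(2) that] by (rule order_trans)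
  ultimately show thesis using that[of l] add scale by blast
qed

end

section \<open>Haar measure and level sets\<close>

lemma sum_indicator_multiples_Suc:
  fixes d y :: real
  shows "(\<Sum>k<Suc n. d * indicator {real (Suc k) * d<..} y) =
    (\<Sum>k<n. d * indicator {real (Suc k) * d<..} y) + (if real n * d + d < y then d else 0)"
  unfolding sum.lessThan_Suc by (auto simp: indicator_def algebra_simps)

text \<open>Each multiple of \<open>d\<close> strictly below \<open>y\<close> contributes
  \<open>d\<close>, so the Riemann sum loses at most one step. The cap \<open>real n * d\<close>
  accounts for the levels beyond the \<open>n\<close>-th and lets the induction go through.\<close>

lemma sum_indicator_multiples_bounds:
  fixes d y :: real
  assumes "0 < d" "0 \<le> y"
  shows "(\<Sum>k<n. d * indicator {real (Suc k) * d<..} y) \<le> min (real n * d) y"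
    and "min (real n * d) (y - d) \<le> (\<Sum>k<n. d * indicator {real (Suc k) * d<..} y)"
proof (induction n)
  case (Suc n)
  have eq: "real (Suc n) * d = real n * d + d" by (simp add: algebra_simps)
  { case 1
    show ?case using Suc assms unfolding sum_indicator_multiples_Suc eq by (smt (verit))
  next
    case 2
    show ?case using Suc assms unfolding sum_indicator_multiples_Suc eq by (smt (verit))
  }
qed (use assms in auto)

lemma suminf_indicator_multiples:
  fixes d y :: real
  assumes d: "0 < d" and y: "0 \<le> y"
  shows "(\<Sum>k. ennreal d * indicator {real (Suc k) * d<..} y) \<le> ennreal y"
    and "ennreal (y - d) \<le> (\<Sum>k. ennreal d * indicator {real (Suc k) * d<..} y)"
proof -
  have part: "(\<Sum>k<n. ennreal d * indicator {real (Suc k) * d<..} y) =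
      ennreal (\<Sum>k<n. d * indicator {real (Suc k) * d<..} y)" for n
  proof -
    have "ennreal d * indicator {real (Suc k) * d<..} y = ennreal (d * indicator {real (Suc k) * d<..} y)" for k
      by (cases "real (Suc k) * d < y") auto
    thus ?thesis using sum_ennreal[of "{..<n}" "\<lambda>k. d * indicator {real (Suc k) * d<..} y"] d by simp
  qed
  show "(\<Sum>k. ennreal d * indicator {real (Suc k) * d<..} y) \<le> ennreal y"
    unfolding suminf_eq_SUP part
    using sum_indicator_multiples_bounds(1)[OF d y] by (auto intro!: SUP_least ennreal_leI)
  \<comment> \<open>For this \<open>n\<close> the cap is inactive: the minimum in the lower bound
    equals \<open>y - d\<close>.\<close>
  obtain n where "y / d < real n" using reals_Archimedean2 by blast
  hence "y - d \<le> real n * d" using d by (simp add: field_simps)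
  hence "ennreal (y - d) \<le> ennreal (\<Sum>k<n. d * indicator {real (Suc k) * d<..} y)"
    using sum_indicator_multiples_bounds(2)[OF d y, of n] by (intro ennreal_leI) auto
  thus "ennreal (y - d) \<le> (\<Sum>k. ennreal d * indicator {real (Suc k) * d<..} y)"
    unfolding suminf_eq_SUP part by (rule SUP_upper2[OF UNIV_I])
qed

text \<open>The layer-cake formula would need \<open>M\<close> to be \<open>\<sigma>\<close>-finite for Fubini; the comparison
  holds without, as both integrals are limits of Riemann sums over the levels.\<close>

lemma nn_integral_le_by_level_sets:
  fixes f g :: "'a \<Rightarrow> real" and K :: ennreal
  assumes [measurable]: "f \<in> borel_measurable M" "g \<in> borel_measurable M"
    and f: "\<And>x. 0 \<le> f x" and g: "\<And>x. 0 \<le> g x"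
    and le: "\<And>c. 0 < c \<Longrightarrow> K * emeasure M {x\<in>space M. c < f x} \<le> emeasure M {x\<in>space M. c < g x}"
  shows "K * (\<integral>\<^sup>+x. ennreal (f x) \<partial>M) \<le> (\<integral>\<^sup>+x. ennreal (g x) \<partial>M)"
proof -
  have sums: "(\<integral>\<^sup>+x. (\<Sum>k. ennreal d * indicator {real (Suc k) * d<..} (h x)) \<partial>M)
      = (\<Sum>k. ennreal d * emeasure M {x\<in>space M. real (Suc k) * d < h x})"
    if [measurable]: "h \<in> borel_measurable M" for h :: "'a \<Rightarrow> real" and d
  proof -
    have "(\<integral>\<^sup>+x. ennreal d * indicator {real (Suc k) * d<..} (h x) \<partial>M)
        = ennreal d * emeasure M {x\<in>space M. real (Suc k) * d < h x}" for k
    proof -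
      have "(\<integral>\<^sup>+x. ennreal d * indicator {real (Suc k) * d<..} (h x) \<partial>M)
          = (\<integral>\<^sup>+x. ennreal d * indicator {x\<in>space M. real (Suc k) * d < h x} x \<partial>M)"
        by (intro nn_integral_cong) (auto simp: indicator_def)
      also have "\<dots> = ennreal d * emeasure M {x\<in>space M. real (Suc k) * d < h x}"
        by (intro nn_integral_cmult_indicator) measurable
      finally show ?thesis .
    qed
    thus ?thesis by (subst nn_integral_suminf) auto
  qed
  \<comment> \<open>Discretising with mesh \<open>d\<close> costs at most \<open>d\<close> in the
    integrand on the left, and the hypothesis on levels applies term by term to the resulting
    series.\<close>
  have step: "K * (\<integral>\<^sup>+x. ennreal (f x - d) \<partial>M) \<le> (\<integral>\<^sup>+x. ennreal (g x) \<partial>M)" if d: "0 < d" for d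
  proof -
    have "(\<integral>\<^sup>+x. ennreal (f x - d) \<partial>M) \<le> (\<integral>\<^sup>+x. (\<Sum>k. ennreal d * indicator {real (Suc k) * d<..} (f x)) \<partial>M)"
      by (intro nn_integral_mono suminf_indicator_multiples(2) d f)
    hence "K * (\<integral>\<^sup>+x. ennreal (f x - d) \<partial>M)
        \<le> K * (\<Sum>k. ennreal d * emeasure M {x\<in>space M. real (Suc k) * d < f x})"
      unfolding sums[OF assms(1)] by (rule mult_left_mono) simp
    also have "\<dots> = (\<Sum>k. ennreal d * (K * emeasure M {x\<in>space M. real (Suc k) * d < f x}))"
      by (subst ennreal_suminf_cmult[symmetric]) (simp add: mult_ac)
    also have "\<dots> \<le> (\<Sum>k. ennreal d * emeasure M {x\<in>space M. real (Suc k) * d < g x})"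
      using d by (intro suminf_le mult_left_mono le) auto
    also have "\<dots> = (\<integral>\<^sup>+x. (\<Sum>k. ennreal d * indicator {real (Suc k) * d<..} (g x)) \<partial>M)"
      by (rule sums[OF assms(2), symmetric])
    also have "\<dots> \<le> (\<integral>\<^sup>+x. ennreal (g x) \<partial>M)"
      by (intro nn_integral_mono suminf_indicator_multiples(1) d g)
    finally show ?thesis .
  qed
  \<comment> \<open>\<open>ennreal\<close> truncates negative values to 0, so these functions
    increase to \<open>f\<close> as the mesh tends to 0, and monotone convergence removes the
    loss.\<close>
  have inc: "incseq (\<lambda>j x. ennreal (f x - 1 / real (Suc j)))"
    by (auto simp: incseq_def le_fun_def intro!: ennreal_leI divide_left_mono)
  have "(SUP j. ennreal (f x - 1 / real (Suc j))) = ennreal (f x)" for x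
  proof (rule LIMSEQ_unique)
    show "(\<lambda>j. ennreal (f x - 1 / real (Suc j))) \<longlonglongrightarrow> (SUP j. ennreal (f x - 1 / real (Suc j)))"
      using inc by (intro LIMSEQ_SUP) (auto simp: incseq_def le_fun_def)
    have "(\<lambda>j. f x - 1 / real (Suc j)) \<longlonglongrightarrow> f x - 0"
      by (intro tendsto_diff tendsto_const) (use LIMSEQ_inverse_real_of_nat in \<open>simp add: inverse_eq_divide\<close>)
    thus "(\<lambda>j. ennreal (f x - 1 / real (Suc j))) \<longlonglongrightarrow> ennreal (f x)"
      by (intro tendsto_ennrealI) simp
  qed
  hence "K * (\<integral>\<^sup>+x. ennreal (f x) \<partial>M) = K * (SUP j. \<integral>\<^sup>+x. ennreal (f x - 1 / real (Suc j)) \<partial>M)"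
    by (subst nn_integral_monotone_convergence_SUP[OF inc, symmetric]) auto
  also have "\<dots> = (SUP j. K * (\<integral>\<^sup>+x. ennreal (f x - 1 / real (Suc j)) \<partial>M))"
    by (rule SUP_mult_left_ennreal)
  also have "\<dots> \<le> (\<integral>\<^sup>+x. ennreal (g x) \<partial>M)"
    by (intro SUP_least step) simp
  finally show ?thesis .
qed

section \<open>Left Haar measure: translation invariance and approximation by compact sets\<close>

lemma left_haar_measureD:
  assumes "left_haar_measure m"
  shows left_haar_measure_sets: "sets m = sets borel"
    and left_haar_measure_space: "space m = UNIV"
    and left_haar_measure_compact: "compact K \<Longrightarrow> emeasure m K < \<infinity>"
    and left_haar_measure_outer:
      "A \<in> sets borel \<Longrightarrow> emeasure m A = (INF U\<in>{U. open U \<and> A \<subseteq> U}. emeasure m U)"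
    and left_haar_measure_inner:
      "open U \<Longrightarrow> emeasure m U = (SUP K\<in>{K. compact K \<and> K \<subseteq> U}. emeasure m K)"
    and left_haar_measure_image: "A \<in> sets borel \<Longrightarrow> emeasure m ((\<lambda>t. s + t) ` A) = emeasure m A"
proof -
  note defs = assms[unfolded left_haar_measure_def]
  show "sets m = sets borel" using defs by (elim conjE)
  thus "space m = UNIV" using sets_eq_imp_space_eq[of m borel] by simp
  show "compact K \<Longrightarrow> emeasure m K < \<infinity>" using defs by (elim conjE) iprover
  show "A \<in> sets borel \<Longrightarrow> emeasure m A = (INF U\<in>{U. open U \<and> A \<subseteq> U}. emeasure m U)"
    using defs by (elim conjE) (rule bspec)
  show "open U \<Longrightarrow> emeasure m U = (SUP K\<in>{K. compact K \<and> K \<subseteq> U}. emeasure m K)"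
    using defs by (elim conjE) iprover
  show "A \<in> sets borel \<Longrightarrow> emeasure m ((\<lambda>t. s + t) ` A) = emeasure m A"
    using defs unfolding Ball_def by (elim conjE) iprover
qed

lemma continuous_on_plus_left: "continuous_on S (\<lambda>t. s + t :: 'g::topological_group_add)"
  by (intro continuous_intros)

lemma image_plus_eq_vimage: "(\<lambda>t. s + t) ` A = (\<lambda>t. - s + t) -` (A :: 'g::group_add set)"
proof (intro set_eqI iffI)
  fix t assume "t \<in> (\<lambda>t. - s + t) -` A"
  thus "t \<in> (\<lambda>t. s + t) ` A" by (intro image_eqI[of _ _ "- s + t"]) (simp_all add: add.assoc[symmetric])
qed (auto simp: add.assoc[symmetric])

lemma sets_image_plus:
  fixes A :: "'g::topological_group_add set"
  assumes "A \<in> sets borel"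
  shows "(\<lambda>t. s + t) ` A \<in> sets borel"
  unfolding image_plus_eq_vimage
  using measurable_sets[OF borel_measurable_continuous_onI[OF continuous_on_plus_left] assms] by simp

text \<open>Invariance as an equality of measures, the form in which it passes to integrals.\<close>

lemma distr_plus_left_haar:
  assumes m: "left_haar_measure m"
  shows "distr m m (\<lambda>t. s + t) = m"
proof (rule measure_eqI)
  fix A assume A: "A \<in> sets (distr m m (\<lambda>t. s + t))"
  have [measurable]: "(\<lambda>t. s + t) \<in> m \<rightarrow>\<^sub>M m"
    unfolding measurable_cong_sets[OF left_haar_measure_sets[OF m] left_haar_measure_sets[OF m]]
    by (rule borel_measurable_continuous_onI[OF continuous_on_plus_left])
  have "emeasure (distr m m (\<lambda>t. s + t)) A = emeasure m ((\<lambda>t. s + t) -` A)"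
    using A by (subst emeasure_distr) (auto simp: left_haar_measure_space[OF m])
  also have "(\<lambda>t. s + t) -` A = (\<lambda>t. - s + t) ` A"
    by (simp add: image_plus_eq_vimage)
  also have "emeasure m \<dots> = emeasure m A"
    using A by (intro left_haar_measure_image[OF m]) (simp add: left_haar_measure_sets[OF m])
  finally show "emeasure (distr m m (\<lambda>t. s + t)) A = emeasure m A" .
qed simp

lemma
  fixes f :: "'g::{topological_group_add,t2_space} \<Rightarrow> 'b::{banach,second_countable_topology}"
  assumes m: "left_haar_measure m" and f: "integrable m f"
  shows integrable_plus_left_haar: "integrable m (\<lambda>t. f (s + t))"
    and integral_plus_left_haar: "(\<integral>t. f (s + t) \<partial>m) = (\<integral>t. f t \<partial>m)"
proof -
  have meas: "(\<lambda>t. s + t) \<in> m \<rightarrow>\<^sub>M m"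
    unfolding measurable_cong_sets[OF left_haar_measure_sets[OF m] left_haar_measure_sets[OF m]]
    by (rule borel_measurable_continuous_onI[OF continuous_on_plus_left])
  have f': "f \<in> borel_measurable m" using f by simp
  show "integrable m (\<lambda>t. f (s + t))"
    using f integrable_distr[OF meas, of f] distr_plus_left_haar[OF m] by simp
  show "(\<integral>t. f (s + t) \<partial>m) = (\<integral>t. f t \<partial>m)"
    using integral_distr[OF meas f'] distr_plus_left_haar[OF m] by simp
qed

text \<open>Haar measure is by definition inner regular on open sets; this extends it to sets of
  finite measure. With \<open>U\<close> open around \<open>A\<close>, \<open>K\<close> compact in
  \<open>U\<close> and \<open>V\<close> open around \<open>U - A\<close>, the set
  \<open>K - V\<close> is compact and contained in \<open>A\<close>.\<close>

lemma left_haar_measure_inner_finite: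
  assumes m: "left_haar_measure m" and A: "A \<in> sets borel" "emeasure m A < \<infinity>" and e: "0 < e"
  obtains S where "compact S" "S \<subseteq> A" "measure m A - e < measure m S"
proof -
  \<comment> \<open>The loss of \<open>K\<close> in \<open>U\<close> and the excess of
    \<open>V\<close> over \<open>U - A\<close> are each below \<open>d\<close>, and together they
    stay below \<open>e\<close>.\<close>
  define d where "d = e / 3"
  have d: "0 < d" using e by (simp add: d_def)
  have outer: "\<exists>U. open U \<and> B \<subseteq> U \<and> emeasure m U < emeasure m B + ennreal d"
    if "B \<in> sets borel" "emeasure m B < \<infinity>" for B
  proof -
    have "emeasure m B < emeasure m B + ennreal d"
      using that(2) d by (cases "emeasure m B") (auto simp: ennreal_less_iff simp flip: ennreal_plus)
    hence "(INF U\<in>{U. open U \<and> B \<subseteq> U}. emeasure m U) < emeasure m B + ennreal d"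
      by (subst (asm) (1) left_haar_measure_outer[OF m that(1)])
    thus ?thesis by (auto simp: INF_less_iff)
  qed
  have sets [simp]: "B \<in> sets m \<longleftrightarrow> B \<in> sets borel" for B by (simp add: left_haar_measure_sets[OF m])
  obtain U where U: "open U" "A \<subseteq> U" "emeasure m U < emeasure m A + ennreal d"
    using outer[OF A] by blast
  have Ufin: "emeasure m U < \<infinity>" using U(3) A(2) by (auto intro: less_le_trans simp: less_top[symmetric])
  have UA: "U - A \<in> sets borel" "emeasure m (U - A) < \<infinity>"
    using U A Ufin emeasure_mono[of "U - A" U m] by (auto intro: le_less_trans)
  obtain V where V: "open V" "U - A \<subseteq> V" "emeasure m V < emeasure m (U - A) + ennreal d"
    using outer[OF UA] by blast
  have Vfin: "emeasure m V < \<infinity>" using V(3) UA(2) by (auto intro: less_le_trans simp: less_top[symmetric])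
  have "\<exists>K. compact K \<and> K \<subseteq> U \<and> measure m U - d < measure m K"
  \<comment> \<open>For a negative number \<open>ennreal\<close> gives 0, which need not be strictly
    below \<open>emeasure m U\<close>; the empty set is taken instead.\<close>
  proof (cases "measure m U - d < 0")
    case True
    thus ?thesis by (intro exI[of _ "{}"]) auto
  next
    case False
    hence "ennreal (measure m U - d) < emeasure m U"
      using d Ufin by (subst emeasure_eq_ennreal_measure) (auto simp: ennreal_less_iff)
    then obtain K where K: "compact K" "K \<subseteq> U" "ennreal (measure m U - d) < emeasure m K"
      unfolding left_haar_measure_inner[OF m U(1)] by (auto simp: less_SUP_iff)
    moreover have "emeasure m K = ennreal (measure m K)"
      using left_haar_measure_compact[OF m K(1)] by (intro emeasure_eq_ennreal_measure) auto
    ultimately show ?thesis using False by (auto simp: ennreal_less_iff)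
  qed
  then obtain K where K: "compact K" "K \<subseteq> U" "measure m U - d < measure m K" by blast
  have fm: "U \<in> fmeasurable m" "A \<in> fmeasurable m" "V \<in> fmeasurable m" "K \<in> fmeasurable m"
    using U V K A Ufin Vfin left_haar_measure_compact[OF m K(1)] compact_imp_closed[OF K(1)]
    by (auto simp: fmeasurable_def)
  have "measure m U < measure m A + d"
    using U(3) A(2) Ufin d by (simp add: emeasure_eq_ennreal_measure ennreal_less_iff flip: ennreal_plus)
  moreover have "measure m V < measure m (U - A) + d"
    using V(3) UA(2) Vfin d by (simp add: emeasure_eq_ennreal_measure ennreal_less_iff flip: ennreal_plus)
  moreover have "measure m (U - A) = measure m U - measure m A"
    using U fm by (intro measurable_measure_Diff) auto
  moreover have "measure m K \<le> measure m (K - V) + measure m V"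
  proof -
    have KV: "K - V \<in> fmeasurable m" using fm by (intro fmeasurable.Diff)
    have "measure m K \<le> measure m ((K - V) \<union> V)"
      using fm KV by (intro measure_mono_fmeasurable fmeasurable.Un) (auto dest: fmeasurableD)
    also have "\<dots> \<le> measure m (K - V) + measure m V"
      using fm KV by (intro measure_Un_le fmeasurableD)
    finally show ?thesis .
  qed
  ultimately have "measure m A - e < measure m (K - V)"
    using K(3) e by (simp add: d_def)
  moreover have "compact (K - V)" using K V by (intro compact_diff)
  moreover have "K - V \<subseteq> A" using K V by auto
  ultimately show thesis using that by blast
qed

text \<open>The factor 2 pays for replacing \<open>A\<close> by a compact subset \<open>S\<close> of
  more than half its measure; the numerator can only shrink.\<close>

lemma exists_compact_small_growth:
  assumes m: "left_haar_measure m" and F: "finite F"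
    and A: "A \<in> sets borel" "0 < emeasure m A" "emeasure m A < \<infinity>"
    and K: "0 \<le> K" "emeasure m (\<Union>s\<in>F. (\<lambda>t. s + t) ` A) \<le> ennreal K * emeasure m A"
  shows "\<exists>S. compact S \<and> measure m S > 0 \<and>
      measure m {f + s | f s. f \<in> F \<and> s \<in> S} / measure m S \<le> 2 * K"
proof -
  have posA: "0 < measure m A"
    using A(2,3) by (simp add: measure_def enn2real_positive_iff)
  then obtain S where S: "compact S" "S \<subseteq> A" "measure m A - measure m A / 2 < measure m S"
    using left_haar_measure_inner_finite[OF m A(1,3), of "measure m A / 2"] by auto
  have FS: "{f + s | f s. f \<in> F \<and> s \<in> S} = (\<Union>f\<in>F. (\<lambda>t. f + t) ` S)" by auto
  have "emeasure m (\<Union>f\<in>F. (\<lambda>t. f + t) ` S) \<le> emeasure m (\<Union>s\<in>F. (\<lambda>t. s + t) ` A)"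
    using S(2) F A(1) sets_image_plus by (intro emeasure_mono) (auto simp: left_haar_measure_sets[OF m])
  also have "\<dots> \<le> ennreal (K * measure m A)"
    using K A(3) by (simp add: emeasure_eq_ennreal_measure ennreal_mult)
  finally have "measure m (\<Union>f\<in>F. (\<lambda>t. f + t) ` S) \<le> K * measure m A"
    unfolding measure_def using K(1) by (intro enn2real_leI) auto
  also have "\<dots> \<le> K * (2 * measure m S)"
    using S(3) K(1) by (intro mult_left_mono) auto
  finally show ?thesis
    using S posA by (intro exI[of _ S]) (auto simp: FS field_simps)
qed

section \<open>Duals of seminormed function spaces\<close>

text \<open>These properties allow scaling into the unit ball, hence the bound
  \<open>cmod_dual_le\<close>, and they pass to the dual, so all iterated duals of \<open>L1\<close>
  have them.\<close>

definition seminormed :: "'i fun_space \<Rightarrow> bool" where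
  "seminormed X \<longleftrightarrow>
     (\<lambda>i. 0) \<in> vecs X \<and>
     (\<forall>x\<in>vecs X. \<forall>y\<in>vecs X. \<forall>a b. (\<lambda>i. a * x i + b * y i) \<in> vecs X) \<and>
     (\<forall>x\<in>vecs X. 0 \<le> nrm X x) \<and>
     (\<forall>x\<in>vecs X. \<forall>a. nrm X (\<lambda>i. a * x i) = cmod a * nrm X x)"

lemma seminormed_zero: "seminormed X \<Longrightarrow> (\<lambda>i. 0) \<in> vecs X"
  by (simp add: seminormed_def)

lemma seminormed_lincomb:
  "seminormed X \<Longrightarrow> x \<in> vecs X \<Longrightarrow> y \<in> vecs X \<Longrightarrow> (\<lambda>i. a * x i + b * y i) \<in> vecs X"
  by (simp add: seminormed_def)

lemma seminormed_mult: "seminormed X \<Longrightarrow> x \<in> vecs X \<Longrightarrow> (\<lambda>i. a * x i) \<in> vecs X"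
  using seminormed_lincomb[of X x x a 0] by simp

lemma nrm_nonneg: "seminormed X \<Longrightarrow> x \<in> vecs X \<Longrightarrow> 0 \<le> nrm X x"
  by (simp add: seminormed_def)

lemma nrm_mult: "seminormed X \<Longrightarrow> x \<in> vecs X \<Longrightarrow> nrm X (\<lambda>i. a * x i) = cmod a * nrm X x"
  by (simp add: seminormed_def)

lemma nrm_zero: "seminormed X \<Longrightarrow> nrm X (\<lambda>i. 0) = 0"
  using nrm_mult[of X "\<lambda>i. 0" 0] seminormed_zero[of X] by simp

lemma seminormed_sum:
  fixes n :: nat
  assumes X: "seminormed X" and x: "\<And>i. i < n \<Longrightarrow> x i \<in> vecs X"
  shows "(\<lambda>t. \<Sum>i<n. a i * x i t) \<in> vecs X"
  using x
proof (induction n)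
  case (Suc n)
  show ?case using seminormed_lincomb[OF X, of "\<lambda>t. \<Sum>i<n. a i * x i t" "x n" 1 "a n"] Suc by simp
qed (simp add: seminormed_zero[OF X])

lemma vecs_dual_iff:
  "\<phi> \<in> vecs (dual X) \<longleftrightarrow> (\<forall>x. x \<notin> vecs X \<longrightarrow> \<phi> x = 0) \<and>
     (\<forall>x\<in>vecs X. \<forall>y\<in>vecs X. \<forall>a b. \<phi> (\<lambda>i. a * x i + b * y i) = a * \<phi> x + b * \<phi> y) \<and>
     (\<exists>C. \<forall>x\<in>vecs X. cmod (\<phi> x) \<le> C * nrm X x)"
  by (simp add: dual_def)

lemma dual_outside: "\<phi> \<in> vecs (dual X) \<Longrightarrow> x \<notin> vecs X \<Longrightarrow> \<phi> x = 0"
  by (simp add: vecs_dual_iff)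

lemma dual_lincomb:
  "\<phi> \<in> vecs (dual X) \<Longrightarrow> x \<in> vecs X \<Longrightarrow> y \<in> vecs X \<Longrightarrow>
     \<phi> (\<lambda>i. a * x i + b * y i) = a * \<phi> x + b * \<phi> y"
  by (simp add: vecs_dual_iff)

lemma dual_mult: "\<phi> \<in> vecs (dual X) \<Longrightarrow> x \<in> vecs X \<Longrightarrow> \<phi> (\<lambda>i. a * x i) = a * \<phi> x"
  using dual_lincomb[of \<phi> X x x a 0] by simp

lemma dual_sum:
  fixes n :: nat
  assumes X: "seminormed X" and \<phi>: "\<phi> \<in> vecs (dual X)" and x: "\<And>i. i < n \<Longrightarrow> x i \<in> vecs X"
  shows "\<phi> (\<lambda>t. \<Sum>i<n. a i * x i t) = (\<Sum>i<n. a i * \<phi> (x i))"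
  using x
proof (induction n)
  case 0
  show ?case using dual_mult[OF \<phi> seminormed_zero[OF X], of 0] by simp
next
  case (Suc n)
  have "(\<lambda>t. \<Sum>i<n. a i * x i t) \<in> vecs X" using Suc by (intro seminormed_sum[OF X]) auto
  from dual_lincomb[OF \<phi> this, of "x n" 1 "a n"] Suc show ?case by simp
qed

lemma nrm_dual: "nrm (dual X) \<phi> = (SUP x\<in>{x\<in>vecs X. nrm X x \<le> 1}. cmod (\<phi> x))"
  by (simp add: dual_def)

lemma bdd_above_dual:
  assumes X: "seminormed X" and \<phi>: "\<phi> \<in> vecs (dual X)"
  shows "bdd_above ((\<lambda>x. cmod (\<phi> x)) ` {x\<in>vecs X. nrm X x \<le> 1})"
proof -
  obtain C where C: "\<And>x. x \<in> vecs X \<Longrightarrow> cmod (\<phi> x) \<le> C * nrm X x"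
    using \<phi> unfolding vecs_dual_iff by (elim conjE exE) (blast intro: that)
  have "cmod (\<phi> z) \<le> \<bar>C\<bar>" if "z \<in> vecs X" "nrm X z \<le> 1" for z
  proof -
    have "cmod (\<phi> z) \<le> C * nrm X z" by (rule C[OF that(1)])
    also have "\<dots> \<le> \<bar>C\<bar> * nrm X z" by (intro mult_right_mono nrm_nonneg[OF X] that) simp
    also have "\<dots> \<le> \<bar>C\<bar>" using that by (intro mult_left_le) auto
    finally show ?thesis .
  qed
  thus ?thesis by (intro bdd_aboveI[of _ "\<bar>C\<bar>"]) auto
qed

lemma cmod_dual_le:
  assumes X: "seminormed X" and \<phi>: "\<phi> \<in> vecs (dual X)" and x: "x \<in> vecs X"
  shows "cmod (\<phi> x) \<le> nrm (dual X) \<phi> * nrm X x"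
proof -
  obtain C where C: "\<And>x. x \<in> vecs X \<Longrightarrow> cmod (\<phi> x) \<le> C * nrm X x"
    using \<phi> unfolding vecs_dual_iff by (elim conjE exE) (blast intro: that)
  have unit: "cmod (\<phi> y) \<le> nrm (dual X) \<phi>" if "y \<in> vecs X" "nrm X y \<le> 1" for y
    unfolding nrm_dual using that by (intro cSUP_upper bdd_above_dual[OF X \<phi>]) auto
  show ?thesis
  proof (cases "nrm X x = 0")
    \<comment> \<open>A vector of norm 0 may be non-zero and cannot be scaled to norm 1; boundedness
      of the functional makes it vanish there.\<close>
    case True
    thus ?thesis using C[OF x] by simp
  next
    case False
    hence pos: "0 < nrm X x" using nrm_nonneg[OF X x] by simp
    define y where "y = (\<lambda>i. complex_of_real (inverse (nrm X x)) * x i)"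
    have y: "y \<in> vecs X" unfolding y_def by (rule seminormed_mult[OF X x])
    have "nrm X y \<le> 1" unfolding y_def nrm_mult[OF X x] using pos by (simp add: norm_inverse)
    from unit[OF y this] have "cmod (\<phi> y) \<le> nrm (dual X) \<phi>" .
    also have "\<phi> y = complex_of_real (inverse (nrm X x)) * \<phi> x" unfolding y_def by (rule dual_mult[OF \<phi> x])
    finally show ?thesis using pos by (simp add: norm_divide field_simps)
  qed
qed

lemma nrm_dual_le:
  assumes X: "seminormed X" and C: "0 \<le> C" "\<And>x. x \<in> vecs X \<Longrightarrow> cmod (\<phi> x) \<le> C * nrm X x"
  shows "nrm (dual X) \<phi> \<le> C"
  unfolding nrm_dual
proof (rule cSUP_least)
  show "{x \<in> vecs X. nrm X x \<le> 1} \<noteq> {}" using seminormed_zero[OF X] nrm_zero[OF X] by force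
  fix x assume x: "x \<in> {x \<in> vecs X. nrm X x \<le> 1}"
  have "cmod (\<phi> x) \<le> C * nrm X x" using x C(2) by blast
  also have "\<dots> \<le> C" using x C(1) by (intro mult_left_le) auto
  finally show "cmod (\<phi> x) \<le> C" .
qed

lemma nrm_dual_nonneg:
  assumes X: "seminormed X" and \<phi>: "\<phi> \<in> vecs (dual X)"
  shows "0 \<le> nrm (dual X) \<phi>"
proof -
  have "(\<lambda>i. 0) \<in> {x\<in>vecs X. nrm X x \<le> 1}" using seminormed_zero[OF X] nrm_zero[OF X] by simp
  hence "cmod (\<phi> (\<lambda>i. 0)) \<le> nrm (dual X) \<phi>"
    unfolding nrm_dual by (rule cSUP_upper[OF _ bdd_above_dual[OF X \<phi>]])
  thus ?thesis by (rule order_trans[OF norm_ge_zero])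
qed

lemma seminormed_dual:
  assumes X: "seminormed X"
  shows "seminormed (dual X)"
proof -
  have zero: "(\<lambda>x. 0) \<in> vecs (dual X)"
    unfolding vecs_dual_iff by (auto intro!: exI[of _ 0])
  have lin: "(\<lambda>x. a * \<phi> x + b * \<psi> x) \<in> vecs (dual X)"
    if \<phi>: "\<phi> \<in> vecs (dual X)" and \<psi>: "\<psi> \<in> vecs (dual X)" for \<phi> \<psi> a b
    unfolding vecs_dual_iff
  proof (intro conjI ballI allI impI)
    show "a * \<phi> x + b * \<psi> x = 0" if "x \<notin> vecs X" for x
      using dual_outside[OF \<phi> that] dual_outside[OF \<psi> that] by simp
    show "a * \<phi> (\<lambda>i. c * x i + d * y i) + b * \<psi> (\<lambda>i. c * x i + d * y i) =
        c * (a * \<phi> x + b * \<psi> x) + d * (a * \<phi> y + b * \<psi> y)"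
      if "x \<in> vecs X" "y \<in> vecs X" for x y c d
      using dual_lincomb[OF \<phi> that] dual_lincomb[OF \<psi> that] by (simp add: algebra_simps)
    show "\<exists>C. \<forall>x\<in>vecs X. cmod (a * \<phi> x + b * \<psi> x) \<le> C * nrm X x"
    proof (intro exI ballI)
      fix x assume x: "x \<in> vecs X"
      have "cmod (a * \<phi> x + b * \<psi> x) \<le> cmod a * cmod (\<phi> x) + cmod b * cmod (\<psi> x)"
        by (metis norm_mult norm_triangle_ineq)
      also have "\<dots> \<le> cmod a * (nrm (dual X) \<phi> * nrm X x) + cmod b * (nrm (dual X) \<psi> * nrm X x)"
        by (intro add_mono mult_left_mono cmod_dual_le[OF X] \<phi> \<psi> x) simp_all
      also have "\<dots> = (cmod a * nrm (dual X) \<phi> + cmod b * nrm (dual X) \<psi>) * nrm X x"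
        by (simp add: algebra_simps)
      finally show "cmod (a * \<phi> x + b * \<psi> x) \<le> (cmod a * nrm (dual X) \<phi> + cmod b * nrm (dual X) \<psi>) * nrm X x" .
    qed
  qed
  have le: "nrm (dual X) (\<lambda>x. a * \<phi> x) \<le> cmod a * nrm (dual X) \<phi>" if \<phi>: "\<phi> \<in> vecs (dual X)" for \<phi> a
  proof (rule nrm_dual_le[OF X])
    show "cmod (a * \<phi> x) \<le> cmod a * nrm (dual X) \<phi> * nrm X x" if "x \<in> vecs X" for x
      using mult_left_mono[OF cmod_dual_le[OF X \<phi> that], of "cmod a"] by (simp add: norm_mult mult.assoc)
  qed (simp add: nrm_dual_nonneg[OF X \<phi>])
  have "nrm (dual X) (\<lambda>x. a * \<phi> x) = cmod a * nrm (dual X) \<phi>" if \<phi>: "\<phi> \<in> vecs (dual X)" for \<phi> a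
  proof (cases "a = 0")
    case True
    have "nrm (dual X) (\<lambda>x. 0) = 0"
      using nrm_dual_le[OF X, of 0 "\<lambda>x. 0"] nrm_dual_nonneg[OF X zero] by simp
    with True show ?thesis by simp
  next
    case False
    have mem: "(\<lambda>x. a * \<phi> x) \<in> vecs (dual X)" using lin[OF \<phi> \<phi>, of a 0] by simp
    \<comment> \<open>The inequality \<open>le\<close> for the inverse scalar, applied to the
      multiple of \<open>\<phi>\<close>, yields the reverse inequality.\<close>
    have "(\<lambda>x. inverse a * (a * \<phi> x)) = \<phi>" using False by (simp add: fun_eq_iff)
    with le[OF mem, of "inverse a"] have "nrm (dual X) \<phi> \<le> inverse (cmod a) * nrm (dual X) (\<lambda>x. a * \<phi> x)"
      by (simp add: norm_inverse)
    hence "cmod a * nrm (dual X) \<phi> \<le> nrm (dual X) (\<lambda>x. a * \<phi> x)"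
      using False by (simp add: inverse_eq_divide pos_le_divide_eq mult.commute)
    with le[OF \<phi>, of a] show ?thesis by (rule order_antisym)
  qed
  with zero lin nrm_dual_nonneg[OF X] show ?thesis unfolding seminormed_def by (intro conjI ballI allI)
qed

text \<open>The canonical embedding into the bidual, 0 off the dual as the encoding of functionals
  demands. It lets a functional on \<open>L1\<close> act on the bidual of \<open>L1\<close>.\<close>

definition bidual_eval :: "'i fun_space \<Rightarrow> ('i \<Rightarrow> complex) \<Rightarrow> (('i \<Rightarrow> complex) \<Rightarrow> complex) \<Rightarrow> complex" where
  "bidual_eval X x = (\<lambda>\<phi>. if \<phi> \<in> vecs (dual X) then \<phi> x else 0)"

lemma
  assumes X: "seminormed X" and x: "x \<in> vecs X"
  shows bidual_eval_in_bidual: "bidual_eval X x \<in> vecs (dual (dual X))"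
    and nrm_bidual_eval_le: "nrm (dual (dual X)) (bidual_eval X x) \<le> nrm X x"
proof -
  have bound: "cmod (bidual_eval X x \<phi>) \<le> nrm X x * nrm (dual X) \<phi>" if "\<phi> \<in> vecs (dual X)" for \<phi>
    using cmod_dual_le[OF X that x] that by (simp add: bidual_eval_def mult.commute)
  show "bidual_eval X x \<in> vecs (dual (dual X))"
    unfolding vecs_dual_iff[of _ "dual X"]
  proof (intro conjI ballI allI impI)
    show "bidual_eval X x (\<lambda>i. a * \<phi> i + b * \<psi> i) = a * bidual_eval X x \<phi> + b * bidual_eval X x \<psi>"
      if "\<phi> \<in> vecs (dual X)" "\<psi> \<in> vecs (dual X)" for \<phi> \<psi> a b
      using that seminormed_lincomb[OF seminormed_dual[OF X] that] by (simp add: bidual_eval_def)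
  qed (use bound in \<open>auto simp: bidual_eval_def\<close>)
  show "nrm (dual (dual X)) (bidual_eval X x) \<le> nrm X x"
    by (intro nrm_dual_le[OF seminormed_dual[OF X]] nrm_nonneg[OF X x] bound)
qed

lemma adjoint_op_in_dual:
  assumes X: "seminormed X" and Y: "seminormed Y" and C: "0 \<le> C"
    and T: "\<And>x. x \<in> vecs X \<Longrightarrow> T x \<in> vecs Y" "\<And>x. x \<in> vecs X \<Longrightarrow> nrm Y (T x) \<le> C * nrm X x"
      "\<And>x y a b. x \<in> vecs X \<Longrightarrow> y \<in> vecs X \<Longrightarrow> T (\<lambda>i. a * x i + b * y i) = (\<lambda>j. a * T x j + b * T y j)"
    and \<phi>: "\<phi> \<in> vecs (dual Y)"
  shows "adjoint_op X T \<phi> \<in> vecs (dual X)"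
    and "nrm (dual X) (adjoint_op X T \<phi>) \<le> C * nrm (dual Y) \<phi>"
proof -
  have bound: "cmod (adjoint_op X T \<phi> x) \<le> C * nrm (dual Y) \<phi> * nrm X x" if x: "x \<in> vecs X" for x
  proof -
    have "cmod (\<phi> (T x)) \<le> nrm (dual Y) \<phi> * nrm Y (T x)" by (rule cmod_dual_le[OF Y \<phi> T(1)[OF x]])
    also have "\<dots> \<le> nrm (dual Y) \<phi> * (C * nrm X x)"
      by (intro mult_left_mono T(2) x nrm_dual_nonneg[OF Y \<phi>])
    finally show ?thesis using x by (simp add: adjoint_op_def mult_ac)
  qed
  show "adjoint_op X T \<phi> \<in> vecs (dual X)"
    unfolding vecs_dual_iff
  proof (intro conjI ballI allI impI)
    show "adjoint_op X T \<phi> (\<lambda>i. a * x i + b * y i) = a * adjoint_op X T \<phi> x + b * adjoint_op X T \<phi> y"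
      if "x \<in> vecs X" "y \<in> vecs X" for x y a b
      using that seminormed_lincomb[OF X that] dual_lincomb[OF \<phi> T(1)[OF that(1)] T(1)[OF that(2)]]
      by (simp add: adjoint_op_def T(3))
  qed (use bound in \<open>auto simp: adjoint_op_def\<close>)
  show "nrm (dual X) (adjoint_op X T \<phi>) \<le> C * nrm (dual Y) \<phi>"
    by (intro nrm_dual_le[OF X] bound mult_nonneg_nonneg C nrm_dual_nonneg[OF Y \<phi>])
qed

section \<open>Estimates of the weak 1-summing norm\<close>

lemma cnj_sgn_mult: "cnj (sgn z) * z = complex_of_real (cmod z)"
proof -
  have "cnj (sgn z) * z = (z * cnj z) / complex_of_real (cmod z)"
    unfolding sgn_eq
    by (simp only: complex_cnj_divide complex_cnj_complex_of_real times_divide_eq_left times_divide_eq_right mult.commute)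
  also have "z * cnj z = complex_of_real (cmod z) * complex_of_real (cmod z)"
    using complex_norm_square[of z] by (simp only: power2_eq_square of_real_mult)
  finally show ?thesis by simp
qed

text \<open>\<open>\<Sum> |\<phi> (x i)|\<close> is the value of \<open>\<phi>\<close> at a sum of unimodular multiples of the \<open>x i\<close>.\<close>

lemma weak_summing_norm_1_le:
  assumes X: "seminormed X" and x: "\<And>i. i < n \<Longrightarrow> x i \<in> vecs X"
    and C: "0 \<le> C" "\<And>\<zeta>. (\<And>i. cmod (\<zeta> i) \<le> 1) \<Longrightarrow> nrm X (\<lambda>t. \<Sum>i<n. \<zeta> i * x i t) \<le> C"
  shows "weak_summing_norm 1 X n x \<le> ennreal C"
  unfolding weak_summing_norm_def
proof (rule SUP_least)
  fix \<phi> assume "\<phi> \<in> {\<phi> \<in> vecs (dual X). nrm (dual X) \<phi> \<le> 1}"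
  hence \<phi>: "\<phi> \<in> vecs (dual X)" "nrm (dual X) \<phi> \<le> 1" by auto
  define \<zeta> where "\<zeta> i = cnj (sgn (\<phi> (x i)))" for i
  \<comment> \<open>An inequality only, since \<open>sgn\<close> is 0 where
    \<open>\<phi> (x i)\<close> vanishes.\<close>
  have \<zeta>: "cmod (\<zeta> i) \<le> 1" for i by (simp add: \<zeta>_def norm_sgn)
  have "\<zeta> i * \<phi> (x i) = complex_of_real (cmod (\<phi> (x i)))" for i
    unfolding \<zeta>_def by (rule cnj_sgn_mult)
  hence "complex_of_real (\<Sum>i<n. cmod (\<phi> (x i))) = \<phi> (\<lambda>t. \<Sum>i<n. \<zeta> i * x i t)"
    using dual_sum[OF X \<phi>(1), of n x \<zeta>] x by simp
  hence "cmod (\<phi> (\<lambda>t. \<Sum>i<n. \<zeta> i * x i t)) = \<bar>\<Sum>i<n. cmod (\<phi> (x i))\<bar>"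
    by (metis norm_of_real)
  hence "(\<Sum>i<n. cmod (\<phi> (x i))) = cmod (\<phi> (\<lambda>t. \<Sum>i<n. \<zeta> i * x i t))"
    by (simp add: sum_nonneg)
  also have "\<dots> \<le> nrm (dual X) \<phi> * nrm X (\<lambda>t. \<Sum>i<n. \<zeta> i * x i t)"
    by (intro cmod_dual_le[OF X \<phi>(1)] seminormed_sum[OF X] x)
  also have "\<dots> \<le> 1 * C"
  proof (rule mult_mono)
    show "nrm X (\<lambda>t. \<Sum>i<n. \<zeta> i * x i t) \<le> C" by (rule C(2)[OF \<zeta>])
    show "0 \<le> nrm X (\<lambda>t. \<Sum>i<n. \<zeta> i * x i t)" by (intro nrm_nonneg[OF X] seminormed_sum[OF X] x)
  qed (simp_all add: \<phi>(2))
  finally show "ennreal ((\<Sum>i<n. cmod (\<phi> (x i)) powr 1) powr (1 / 1)) \<le> ennreal C"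
    by (intro ennreal_leI) (simp add: sum_nonneg)
qed

text \<open>The canonical embedding is linear and does not increase norms, so a bound on the
  combinations in \<open>X\<close> carries over to the bidual.\<close>

lemma weak_summing_norm_1_bidual_eval_le:
  assumes X: "seminormed X" and x: "\<And>i. i < n \<Longrightarrow> x i \<in> vecs X"
    and C: "0 \<le> C" "\<And>\<zeta>. (\<And>i. cmod (\<zeta> i) \<le> 1) \<Longrightarrow> nrm X (\<lambda>t. \<Sum>i<n. \<zeta> i * x i t) \<le> C"
  shows "weak_summing_norm 1 (dual (dual X)) n (\<lambda>i. bidual_eval X (x i)) \<le> ennreal C"
proof (rule weak_summing_norm_1_le)
  fix \<zeta> :: "nat \<Rightarrow> complex" assume \<zeta>: "\<And>i. cmod (\<zeta> i) \<le> 1"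
  have eq: "(\<lambda>\<phi>. \<Sum>i<n. \<zeta> i * bidual_eval X (x i) \<phi>) = bidual_eval X (\<lambda>t. \<Sum>i<n. \<zeta> i * x i t)"
  proof
    fix \<phi> show "(\<Sum>i<n. \<zeta> i * bidual_eval X (x i) \<phi>) = bidual_eval X (\<lambda>t. \<Sum>i<n. \<zeta> i * x i t) \<phi>"
      using dual_sum[OF X, of \<phi> n x \<zeta>] x by (cases "\<phi> \<in> vecs (dual X)") (simp_all add: bidual_eval_def)
  qed
  have "nrm (dual (dual X)) (bidual_eval X (\<lambda>t. \<Sum>i<n. \<zeta> i * x i t)) \<le> nrm X (\<lambda>t. \<Sum>i<n. \<zeta> i * x i t)"
    by (intro nrm_bidual_eval_le[OF X] seminormed_sum[OF X] x)
  also have "\<dots> \<le> C" by (rule C(2)[OF \<zeta>])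
  finally show "nrm (dual (dual X)) (\<lambda>\<phi>. \<Sum>i<n. \<zeta> i * bidual_eval X (x i) \<phi>) \<le> C"
    unfolding eq .
qed (simp_all add: C seminormed_dual X bidual_eval_in_bidual x)

section \<open>Functionals and means on \<open>L\<^sup>1\<close>\<close>

lemma vecs_L1: "f \<in> vecs (L1 m) \<longleftrightarrow> integrable m f"
  by (simp add: L1_def)

lemma nrm_L1: "nrm (L1 m) f = (\<integral>t. cmod (f t) \<partial>m)"
  by (simp add: L1_def)

lemma seminormed_L1: "seminormed (L1 m)"
  unfolding seminormed_def nrm_L1 by (auto simp: norm_mult vecs_L1)

definition integral_linear :: "'a measure \<Rightarrow> (('a \<Rightarrow> real) \<Rightarrow> real) \<Rightarrow> bool" where
  "integral_linear m L \<longleftrightarrow> (\<forall>f g a b. integrable m f \<longrightarrow> integrable m g \<longrightarrow>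
     L (\<lambda>t. a * f t + b * g t) = a * L f + b * L g)"

lemma integral_linearD:
  "integral_linear m L \<Longrightarrow> integrable m f \<Longrightarrow> integrable m g \<Longrightarrow>
     L (\<lambda>t. a * f t + b * g t) = a * L f + b * L g"
  by (simp add: integral_linear_def)

lemma integral_linear_mono:
  assumes L: "integral_linear m L" and pos: "\<And>f. integrable m f \<Longrightarrow> (\<And>t. 0 \<le> f t) \<Longrightarrow> 0 \<le> L f"
    and f: "integrable m f" and g: "integrable m g" and le: "\<And>t. f t \<le> g t"
  shows "L f \<le> L g"
proof -
  have "0 \<le> L (\<lambda>t. 1 * g t + (-1) * f t)" using f g le by (intro pos) auto
  thus ?thesis using integral_linearD[OF L g f, of 1 "-1"] by simp
qed

definition complexify :: "'a measure \<Rightarrow> (('a \<Rightarrow> real) \<Rightarrow> real) \<Rightarrow> ('a \<Rightarrow> complex) \<Rightarrow> complex" where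
  "complexify m L = (\<lambda>f. if integrable m f then Complex (L (\<lambda>t. Re (f t))) (L (\<lambda>t. Im (f t))) else 0)"

lemma complexify_lincomb:
  assumes L: "integral_linear m L" and f: "integrable m f" and g: "integrable m g"
  shows "complexify m L (\<lambda>t. a * f t + b * g t) = a * complexify m L f + b * complexify m L g"
proof -
  have fg: "integrable m (\<lambda>t. Re (f t))" "integrable m (\<lambda>t. Im (f t))"
    "integrable m (\<lambda>t. Re (g t))" "integrable m (\<lambda>t. Im (g t))"
    using f g by auto
  have lin4: "L (\<lambda>t. (p * Re (f t) + q * Im (f t)) + (r * Re (g t) + s * Im (g t))) =
      (p * L (\<lambda>t. Re (f t)) + q * L (\<lambda>t. Im (f t))) + (r * L (\<lambda>t. Re (g t)) + s * L (\<lambda>t. Im (g t)))"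
    for p q r s
  proof -
    have "integrable m (\<lambda>t. p * Re (f t) + q * Im (f t))" "integrable m (\<lambda>t. r * Re (g t) + s * Im (g t))"
      using fg by auto
    from integral_linearD[OF L this, of 1 1] show ?thesis
      using integral_linearD[OF L fg(1,2)] integral_linearD[OF L fg(3,4)] by simp
  qed
  have int: "integrable m (\<lambda>t. a * f t + b * g t)" using f g by simp
  have re: "(\<lambda>t. Re (a * f t + b * g t)) =
      (\<lambda>t. (Re a * Re (f t) + (- Im a) * Im (f t)) + (Re b * Re (g t) + (- Im b) * Im (g t)))"
    and im: "(\<lambda>t. Im (a * f t + b * g t)) =
      (\<lambda>t. (Im a * Re (f t) + Re a * Im (f t)) + (Im b * Re (g t) + Re b * Im (g t)))"
    by (auto simp: fun_eq_iff)
  show ?thesis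
    using f g int unfolding complexify_def by (simp only: if_True re im lin4) (simp add: complex_eq_iff)
qed

text \<open>Rotate by the conjugate sign \<open>u\<close> of the value: the value becomes real and
  equals \<open>L\<close> at the real part of \<open>u * f\<close>, which is dominated by
  \<open>cmod f\<close>. Positivity makes \<open>L\<close> monotone.\<close>

lemma cmod_complexify_le:
  assumes L: "integral_linear m L" and pos: "\<And>f. integrable m f \<Longrightarrow> (\<And>t. 0 \<le> f t) \<Longrightarrow> 0 \<le> L f"
    and f: "integrable m f"
  shows "cmod (complexify m L f) \<le> L (\<lambda>t. cmod (f t))"
proof -
  define z where "z = complexify m L f"
  define u where "u = cnj (sgn z)"
  have u: "cmod u \<le> 1" by (simp add: u_def norm_sgn)
  have "cmod z = Re (u * z)"
    unfolding u_def cnj_sgn_mult by simp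
  also have "u * z = complexify m L (\<lambda>t. u * f t)"
    using complexify_lincomb[OF L f f, of u 0] by (simp add: z_def)
  also have "Re \<dots> = L (\<lambda>t. Re (u * f t))"
    using f by (simp add: complexify_def del: times_complex.sel)
  also have "\<dots> \<le> L (\<lambda>t. cmod (f t))"
  proof (rule integral_linear_mono[OF L pos])
    show "Re (u * f t) \<le> cmod (f t)" for t
    proof -
      have "Re (u * f t) \<le> cmod (u * f t)" by (rule complex_Re_le_cmod)
      also have "\<dots> \<le> cmod (f t)" using u by (simp add: norm_mult mult_right_le_one_le mult_left_le_one_le)
      finally show ?thesis .
    qed
    show "integrable m (\<lambda>t. Re (u * f t))" using f by (intro integrable_Re integrable_mult_right) auto
    show "integrable m (\<lambda>t. cmod (f t))" using f by (rule integrable_norm)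
  qed
  finally show ?thesis by (simp add: z_def)
qed

lemma complexify_in_dual:
  assumes L: "integral_linear m L" and pos: "\<And>f. integrable m f \<Longrightarrow> (\<And>t. 0 \<le> f t) \<Longrightarrow> 0 \<le> L f"
    and le: "\<And>f. integrable m f \<Longrightarrow> (\<And>t. 0 \<le> f t) \<Longrightarrow> L f \<le> C * (\<integral>t. f t \<partial>m)"
  shows "complexify m L \<in> vecs (dual (L1 m))"
  unfolding vecs_dual_iff vecs_L1 nrm_L1
proof (intro conjI ballI allI impI)
  show "complexify m L f = 0" if "\<not> integrable m f" for f using that by (simp add: complexify_def)
  show "\<exists>C. \<forall>f\<in>vecs (L1 m). cmod (complexify m L f) \<le> C * (\<integral>t. cmod (f t) \<partial>m)"
  proof (intro exI ballI)
    fix f assume "f \<in> vecs (L1 m)"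
    hence f: "integrable m f" by (simp add: vecs_L1)
    have "cmod (complexify m L f) \<le> L (\<lambda>t. cmod (f t))" by (rule cmod_complexify_le[OF L pos f])
    also have "\<dots> \<le> C * (\<integral>t. cmod (f t) \<partial>m)" using f by (intro le) auto
    finally show "cmod (complexify m L f) \<le> C * (\<integral>t. cmod (f t) \<partial>m)" .
  qed
qed (simp add: complexify_lincomb[OF L] vecs_L1)

text \<open>Positivity of means: \<open>N \<cdot> 1 - L\<close> has norm at most \<open>N - K\<close>.\<close>

lemma mean_complexify_ge:
  assumes \<Lambda>: "mean m \<Lambda>" and L: "integral_linear m L" and K: "0 \<le> K" "K \<le> N"
    and ge: "\<And>f. integrable m f \<Longrightarrow> (\<And>t. 0 \<le> f t) \<Longrightarrow> K * (\<integral>t. f t \<partial>m) \<le> L f"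
    and le: "\<And>f. integrable m f \<Longrightarrow> (\<And>t. 0 \<le> f t) \<Longrightarrow> L f \<le> N * (\<integral>t. f t \<partial>m)"
  shows "K \<le> Re (\<Lambda> (complexify m L))"
proof -
  let ?I = "Linf_functional m (\<lambda>t. 1)"
  have \<Lambda>in: "\<Lambda> \<in> vecs (dual (dual (L1 m)))" and \<Lambda>1: "\<Lambda> ?I = 1" and \<Lambda>n: "nrm (dual (dual (L1 m))) \<Lambda> = 1"
    using \<Lambda> by (auto simp: mean_def)
  have intlin: "integral_linear m (\<lambda>f. \<integral>t. f t \<partial>m)" by (simp add: integral_linear_def)
  have posI: "0 \<le> (\<integral>t. f t \<partial>m)" if "\<And>t. 0 \<le> f t" for f :: "'a \<Rightarrow> real" using that by simp
  have Ieq: "?I = complexify m (\<lambda>f. \<integral>t. f t \<partial>m)"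
    by (auto simp: Linf_functional_def complexify_def vecs_L1 fun_eq_iff complex_eq_iff)
  have Iin: "?I \<in> vecs (dual (L1 m))"
    unfolding Ieq by (rule complexify_in_dual[OF intlin, of 1]) auto
  have posL: "0 \<le> L f" if "integrable m f" "\<And>t. 0 \<le> f t" for f
    using ge[OF that] mult_nonneg_nonneg[OF K(1) posI[of f, OF that(2)]] by linarith
  have Lin: "complexify m L \<in> vecs (dual (L1 m))"
    by (rule complexify_in_dual[OF L posL le])
  define M where "M f = N * (\<integral>t. f t \<partial>m) - L f" for f
  have M: "integral_linear m M"
    unfolding integral_linear_def M_def using integral_linearD[OF L]
    by (simp add: algebra_simps)
  have Meq: "complexify m M = (\<lambda>f. complex_of_real N * ?I f + (-1) * complexify m L f)"
    unfolding Ieq by (auto simp: complexify_def M_def complex_eq_iff fun_eq_iff)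
  have "nrm (dual (L1 m)) (complexify m M) \<le> N - K"
  proof (rule nrm_dual_le[OF seminormed_L1])
    fix f assume "f \<in> vecs (L1 m)"
    hence f: "integrable m f" by (simp add: vecs_L1)
    \<comment> \<open>\<open>M\<close> is positive by \<open>le\<close>, hence dominated by its
      value at \<open>cmod f\<close>; the lower bound \<open>ge\<close> for \<open>L\<close> then
      caps that value.\<close>
    have "cmod (complexify m M f) \<le> M (\<lambda>t. cmod (f t))"
      using le by (intro cmod_complexify_le[OF M _ f]) (simp add: M_def)
    also have "\<dots> \<le> (N - K) * nrm (L1 m) f"
      using ge[of "\<lambda>t. cmod (f t)"] f by (simp add: M_def nrm_L1 algebra_simps)
    finally show "cmod (complexify m M f) \<le> (N - K) * nrm (L1 m) f" .
  qed (use K in simp)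
  moreover have "complexify m M \<in> vecs (dual (L1 m))"
    unfolding Meq by (intro seminormed_lincomb seminormed_dual seminormed_L1 Iin Lin)
  ultimately have "cmod (\<Lambda> (complexify m M)) \<le> N - K"
    using cmod_dual_le[OF seminormed_dual[OF seminormed_L1] \<Lambda>in, of "complexify m M"] \<Lambda>n by simp
  moreover have "\<Lambda> (complexify m M) = complex_of_real N - \<Lambda> (complexify m L)"
    unfolding Meq using dual_lincomb[OF \<Lambda>in Iin Lin, of "complex_of_real N" "-1"] \<Lambda>1 by simp
  ultimately have "N - Re (\<Lambda> (complexify m L)) \<le> N - K"
    using complex_Re_le_cmod[of "\<Lambda> (complexify m M)"] by simp
  thus ?thesis by simp
qed

section \<open>Separation and the choice of the set\<close>

text \<open>The entry 0 in the maximum is what makes linear functionals below its integral positive: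
  a tuple with non-positive entries has maximum 0.\<close>

primrec pos_max :: "(nat \<Rightarrow> 'a \<Rightarrow> real) \<Rightarrow> nat \<Rightarrow> 'a \<Rightarrow> real" where
  "pos_max g 0 t = 0"
| "pos_max g (Suc n) t = max (g n t) (pos_max g n t)"

lemma pos_max_nonneg: "0 \<le> pos_max g n t"
  by (induction n) auto

lemma pos_max_ge: "i < n \<Longrightarrow> g i t \<le> pos_max g n t"
  by (induction n) (auto simp: less_Suc_eq)

lemma pos_max_le: "0 \<le> b \<Longrightarrow> (\<And>i. i < n \<Longrightarrow> g i t \<le> b) \<Longrightarrow> pos_max g n t \<le> b"
  by (induction n) auto

lemma less_pos_max_iff: "0 \<le> c \<Longrightarrow> c < pos_max g n t \<longleftrightarrow> (\<exists>i<n. c < g i t)"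
  by (induction n) (auto simp: less_Suc_eq less_max_iff_disj)

lemma pos_max_cong: "(\<And>i. i < n \<Longrightarrow> g i t = h i t) \<Longrightarrow> pos_max g n t = pos_max h n t"
  by (induction n) auto

lemma pos_max_add_le: "pos_max (\<lambda>i t. g i t + h i t) n t \<le> pos_max g n t + pos_max h n t"
  by (intro pos_max_le add_nonneg_nonneg add_mono pos_max_nonneg pos_max_ge)

lemma pos_max_mult: "0 \<le> a \<Longrightarrow> pos_max (\<lambda>i t. a * g i t) n t = a * pos_max g n t"
  by (induction n) (auto simp: max_mult_distrib_left)

lemma integrable_pos_max:
  assumes "\<And>i. integrable m (g i)"
  shows "integrable m (pos_max g n)"
proof (induction n)
  case 0
  show ?case by (simp cong: integrable_cong)
next
  case (Suc n)
  have "integrable m (\<lambda>t. max (g n t) (pos_max g n t))"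
    using assms Suc by (rule integrable_max)
  thus ?case by simp
qed

text \<open>Hahn--Banach for the functional \<open>g \<mapsto> \<integral> max (0, g\<^sub>0, \<dots>, g\<^sub>n\<^sub>-\<^sub>1)\<close> and the cone of the tuples of
  translates of one non-negative function.\<close>

lemma exists_separating_functionals:
  fixes m :: "'g::{topological_group_add,t2_space} measure" and s :: "nat \<Rightarrow> 'g"
  assumes m: "left_haar_measure m" and n: "0 < n"
    and ge: "\<And>f. integrable m f \<Longrightarrow> (\<And>t. 0 \<le> f t) \<Longrightarrow>
      K * (\<integral>t. f t \<partial>m) \<le> (\<integral>t. pos_max (\<lambda>i t. f (- s i + t)) n t \<partial>m)"
  obtains L where "\<And>i. integral_linear m (L i)"
    "\<And>g. (\<And>i. integrable m (g i)) \<Longrightarrow> (\<Sum>i<n. L i (g i)) \<le> (\<integral>t. pos_max g n t \<partial>m)"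
    "\<And>f. integrable m f \<Longrightarrow> (\<And>t. 0 \<le> f t) \<Longrightarrow>
      K * (\<integral>t. f t \<partial>m) \<le> (\<Sum>i<n. L i (\<lambda>t. f (- s i + t)))"
proof -
  define scale where "scale = (\<lambda>(c::real) (g::nat \<Rightarrow> 'g \<Rightarrow> real) i t. c * g i t)"
  interpret real_linear_space scale
    by unfold_locales (simp_all add: scale_def fun_eq_iff algebra_simps)
  have add_eq: "g + h = (\<lambda>i t. g i t + h i t)" for g h :: "nat \<Rightarrow> 'g \<Rightarrow> real"
    by (simp add: fun_eq_iff)
  have zero_eq: "(0 :: nat \<Rightarrow> 'g \<Rightarrow> real) = (\<lambda>i t. 0)"
    by (simp add: fun_eq_iff)
  note ops = add_eq zero_eq scale_def
  define V where "V = {g :: nat \<Rightarrow> 'g \<Rightarrow> real. \<forall>i. integrable m (g i)}"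
  define p where "p g = (\<integral>t. pos_max g n t \<partial>m)" for g :: "nat \<Rightarrow> 'g \<Rightarrow> real"
  \<comment> \<open>\<open>V\<close> consists of infinite sequences, of which \<open>p\<close> sees
    the first \<open>n\<close> entries. Truncation puts 0 in the others, so that \<open>l\<close>
    becomes a finite sum over coordinates.\<close>
  define trunc where "trunc k g = (\<lambda>i t. if i < k then g i t else 0)" for k and g :: "nat \<Rightarrow> 'g \<Rightarrow> real"
  define trans where "trans f = (\<lambda>i t. f (- s i + t))" for f :: "'g \<Rightarrow> real"
  define D where "D = {trunc n (trans f) | f. integrable m f \<and> (\<forall>t. 0 \<le> f t)}"
  \<comment> \<open>By left invariance the entry 0 of a tuple of translates, present because
    \<open>0 < n\<close>, has the same integral as \<open>f\<close>. Reading it off the tuple makes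
    \<open>c\<close> additive without a choice of \<open>f\<close>.\<close>
  define c where "c g = K * (\<integral>t. g 0 t \<partial>m)" for g :: "nat \<Rightarrow> 'g \<Rightarrow> real"
  have V: "subspace V"
    by (rule subspaceI) (auto simp: V_def ops)
  have p: "sublinear_on V p"
    unfolding sublinear_on_def
  proof (intro conjI ballI allI impI)
    fix g h assume "g \<in> V" "h \<in> V"
    hence int: "integrable m (g i)" "integrable m (h i)" for i by (auto simp: V_def)
    have "p (g + h) \<le> (\<integral>t. pos_max g n t + pos_max h n t \<partial>m)"
      unfolding p_def add_eq using int
      by (intro integral_mono integrable_pos_max Bochner_Integration.integrable_add pos_max_add_le)
    also have "\<dots> = p g + p h"
      unfolding p_def using int by (intro Bochner_Integration.integral_add integrable_pos_max)
    finally show "p (g + h) \<le> p g + p h" .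
  qed (simp add: p_def scale_def pos_max_mult)
  have transV: "integrable m (trans f i)" if "integrable m f" for f i
    unfolding trans_def by (rule integrable_plus_left_haar[OF m that])
  have truncV: "trunc k g \<in> V" if "\<And>i. integrable m (g i)" for k g
    unfolding V_def trunc_def
  proof (intro CollectI allI)
    show "integrable m (\<lambda>t. if i < k then g i t else 0)" for i
      using that by (cases "i < k") auto
  qed
  have p_trunc: "p (trunc n g) = p g" for g
    unfolding p_def by (intro Bochner_Integration.integral_cong pos_max_cong) (auto simp: trunc_def)
  have c_trunc: "c (trunc n (trans f)) = K * (\<integral>t. f t \<partial>m)" if "integrable m f" for f
    using integral_plus_left_haar[OF m that] n by (simp add: c_def trunc_def trans_def)
  have DV: "D \<subseteq> V" using truncV transV by (auto simp: D_def)
  have D: "0 \<in> D" "\<forall>x\<in>D. \<forall>y\<in>D. x + y \<in> D" "\<forall>x\<in>D. \<forall>a\<ge>0. scale a x \<in> D"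
  proof -
    show "0 \<in> D"
      unfolding D_def by (intro CollectI exI[of _ "\<lambda>t. 0"]) (auto simp: ops trunc_def trans_def)
    show "\<forall>x\<in>D. \<forall>y\<in>D. x + y \<in> D"
    proof (intro ballI)
      fix x y assume "x \<in> D" "y \<in> D"
      then obtain f g where "x = trunc n (trans f)" "y = trunc n (trans g)" "integrable m f" "integrable m g"
        "\<And>t. 0 \<le> f t" "\<And>t. 0 \<le> g t"
        unfolding D_def by auto
      thus "x + y \<in> D"
        unfolding D_def by (intro CollectI exI[of _ "\<lambda>t. f t + g t"]) (auto simp: ops trunc_def trans_def fun_eq_iff)
    qed
    show "\<forall>x\<in>D. \<forall>a\<ge>0. scale a x \<in> D"
    proof (intro ballI allI impI)
      fix x and a :: real assume "x \<in> D" "0 \<le> a"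
      moreover then obtain f where "x = trunc n (trans f)" "integrable m f" "\<And>t. 0 \<le> f t"
        unfolding D_def by auto
      ultimately show "scale a x \<in> D"
        unfolding D_def by (intro CollectI exI[of _ "\<lambda>t. a * f t"]) (auto simp: ops trunc_def trans_def fun_eq_iff)
    qed
  qed
  have c: "\<forall>x\<in>D. \<forall>y\<in>D. c (x + y) = c x + c y" "\<forall>x\<in>D. \<forall>a\<ge>0. c (scale a x) = a * c x"
    using DV by (auto simp: c_def ops V_def algebra_simps subset_iff)
  have cp: "\<forall>x\<in>D. c x \<le> p x"
  proof
    fix x assume "x \<in> D"
    then obtain f where f: "x = trunc n (trans f)" "integrable m f" "\<And>t. 0 \<le> f t"
      unfolding D_def by auto
    show "c x \<le> p x"
      using ge[OF f(2,3)] unfolding f(1) c_trunc[OF f(2)] p_trunc unfolding p_def trans_def .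
  qed
  obtain l where l_add: "\<And>x y. x \<in> V \<Longrightarrow> y \<in> V \<Longrightarrow> l (x + y) = l x + l y"
    and l_scale: "\<And>a x. x \<in> V \<Longrightarrow> l (scale a x) = a * l x"
    and l_le: "\<And>x. x \<in> V \<Longrightarrow> l x \<le> p x" and l_ge: "\<And>x. x \<in> D \<Longrightarrow> c x \<le> l x"
    using hahn_banach_sandwich[OF V p DV D c cp] by blast
  \<comment> \<open>The embedding of the \<open>i\<close>-th coordinate; \<open>L i\<close> is
    \<open>l\<close> restricted to that coordinate.\<close>
  define single where "single i f = (\<lambda>j t. if j = i then f t else 0)" for i :: nat and f :: "'g \<Rightarrow> real"
  have singleV: "single i f \<in> V" if "integrable m f" for i f
    unfolding V_def single_def
  proof (intro CollectI allI)
    show "integrable m (\<lambda>t. if j = i then f t else 0)" for j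
      using that by (cases "j = i") auto
  qed
  define L where "L i f = l (single i f)" for i f
  have L: "integral_linear m (L i)" for i
    unfolding integral_linear_def
  proof (intro allI impI)
    fix f g :: "'g \<Rightarrow> real" and a b :: real assume f: "integrable m f" and g: "integrable m g"
    have "single i (\<lambda>t. a * f t + b * g t) = scale a (single i f) + scale b (single i g)"
      by (simp add: ops single_def fun_eq_iff)
    thus "L i (\<lambda>t. a * f t + b * g t) = a * L i f + b * L i g"
      using f g V by (simp add: L_def l_add l_scale singleV subspace_scale)
  qed
  have l_trunc: "l (trunc k g) = (\<Sum>i<k. L i (g i))" if g: "\<And>i. integrable m (g i)" for k g
  proof (induction k)
    case 0
    have "trunc 0 g = scale 0 0" by (simp add: ops trunc_def)
    hence "l (trunc 0 g) = 0 * l 0" using l_scale[OF subspace_0[OF V], of 0] by (simp only:)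
    thus ?case by (simp only: mult_zero_left lessThan_0 sum.empty)
  next
    case (Suc k)
    have eq: "trunc (Suc k) g = trunc k g + single k (g k)"
      by (auto simp: ops trunc_def single_def fun_eq_iff less_Suc_eq)
    have "l (trunc (Suc k) g) = l (trunc k g) + l (single k (g k))"
      unfolding eq by (intro l_add truncV singleV g)
    thus ?case by (simp only: Suc.IH sum.lessThan_Suc L_def)
  qed
  show thesis
  proof (rule that[of L])
    show "integral_linear m (L i)" for i by (rule L)
    show "(\<Sum>i<n. L i (g i)) \<le> (\<integral>t. pos_max g n t \<partial>m)" if g: "\<And>i. integrable m (g i)" for g
      using l_le[OF truncV[OF g], of n] unfolding l_trunc[OF g] p_trunc unfolding p_def .
    show "K * (\<integral>t. f t \<partial>m) \<le> (\<Sum>i<n. L i (\<lambda>t. f (- s i + t)))"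
      if f: "integrable m f" "\<And>t. 0 \<le> f t" for f
    proof -
      have "trunc n (trans f) \<in> D" unfolding D_def using f by blast
      from l_ge[OF this] show ?thesis
        unfolding c_trunc[OF f(1)] l_trunc[OF transV[OF f(1)]] unfolding trans_def .
    qed
  qed
qed

section \<open>The translation action, and what the invariant mean yields\<close>

lemma translate_L1:
  fixes m :: "'g::{topological_group_add,t2_space} measure"
  assumes m: "left_haar_measure m" and f: "f \<in> vecs (L1 m)"
  shows translate_in_L1: "translate s f \<in> vecs (L1 m)"
    and nrm_translate_L1: "nrm (L1 m) (translate s f) = nrm (L1 m) f"
proof -
  have f': "integrable m f" using f by (simp add: vecs_L1)
  show "translate s f \<in> vecs (L1 m)"
    unfolding translate_def vecs_L1 by (rule integrable_plus_left_haar[OF m f'])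
  show "nrm (L1 m) (translate s f) = nrm (L1 m) f"
    unfolding translate_def nrm_L1 by (rule integral_plus_left_haar[OF m integrable_norm[OF f']])
qed

lemma bidual_action_in_bidual:
  fixes m :: "'g::{topological_group_add,t2_space} measure"
  assumes m: "left_haar_measure m" and \<Lambda>: "\<Lambda> \<in> vecs (dual (dual (L1 m)))"
  shows "bidual_action m s \<Lambda> \<in> vecs (dual (dual (L1 m)))"
proof -
  let ?T = "adjoint_op (L1 m) (translate s)"
  have T: "?T \<phi> \<in> vecs (dual (L1 m))" "nrm (dual (L1 m)) (?T \<phi>) \<le> 1 * nrm (dual (L1 m)) \<phi>"
    if "\<phi> \<in> vecs (dual (L1 m))" for \<phi>
    using adjoint_op_in_dual[of "L1 m" "L1 m" 1 "translate s" \<phi>, OF seminormed_L1 seminormed_L1 _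
        translate_in_L1[OF m] _ _ that] nrm_translate_L1[OF m]
    by (simp_all add: translate_def)
  show ?thesis
    unfolding bidual_action_def
    by (rule adjoint_op_in_dual(1)[OF seminormed_dual[OF seminormed_L1] seminormed_dual[OF seminormed_L1] _ T _ \<Lambda>])
      (auto simp: adjoint_op_def fun_eq_iff)
qed

text \<open>If \<open>a\<close> exceeds \<open>M\<close>, then \<open>a powr (1 - q)\<close> is at
  most \<open>M powr (1 - q)\<close>. Summed over \<open>n\<close> numbers, this turns a bound on
  the \<open>q\<close>-th powers into a bound on the sum with slope \<open>M\<close> in
  \<open>n\<close>, which can be made small.\<close>

lemma le_add_powr:
  fixes a M q :: real
  assumes "0 \<le> a" "0 < M" "1 < q"
  shows "a \<le> M + M powr (1 - q) * a powr q"
proof (cases "a \<le> M")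
  case True
  moreover have "0 \<le> M powr (1 - q) * a powr q" by simp
  ultimately show ?thesis by linarith
next
  case False
  hence "a = a powr (1 - q) * a powr q" using assms by (simp flip: powr_add)
  also have "\<dots> \<le> M powr (1 - q) * a powr q"
    using False assms by (intro mult_right_mono powr_mono2') auto
  finally show ?thesis using assms by linarith
qed

text \<open>The threshold for \<open>K\<close> is the bound on \<open>\<Sum>i<n. a i\<close>
  obtained from \<open>le_add_powr\<close> and multi-invariance. If no such \<open>f\<close>
  existed, separation and the mean would force that sum to be at least \<open>K\<close>.\<close>

lemma exists_small_pos_max:
  fixes m :: "'g::{topological_group_add,t2_space} measure" and s :: "nat \<Rightarrow> 'g"
  assumes m: "left_haar_measure m" and q: "1 < q" and \<Lambda>: "mean m \<Lambda>"
    and C: "0 \<le> C" "weak_multi_norm 1 q (dual (dual (L1 m))) n (\<lambda>i. bidual_action m (s i) \<Lambda>) \<le> ennreal C"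
    and n: "0 < n" and M: "0 < M" and K: "real n * M + M powr (1 - q) * C powr q < K"
  obtains f where "integrable m f" "\<And>t. 0 \<le> f t"
    "(\<integral>t. pos_max (\<lambda>i t. f (- s i + t)) n t \<partial>m) < K * (\<integral>t. f t \<partial>m)"
proof (rule ccontr)
  assume "\<not> thesis"
  with that have "K * (\<integral>t. f t \<partial>m) \<le> (\<integral>t. pos_max (\<lambda>i t. f (- s i + t)) n t \<partial>m)"
    if "integrable m f" "\<And>t. 0 \<le> f t" for f
    using that by (meson not_le)
  then obtain L where L: "\<And>i. integral_linear m (L i)"
    and L_le: "\<And>g. (\<And>i. integrable m (g i)) \<Longrightarrow> (\<Sum>i<n. L i (g i)) \<le> (\<integral>t. pos_max g n t \<partial>m)"
    and L_ge: "\<And>f. integrable m f \<Longrightarrow> (\<And>t. 0 \<le> f t) \<Longrightarrow>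
      K * (\<integral>t. f t \<partial>m) \<le> (\<Sum>i<n. L i (\<lambda>t. f (- s i + t)))"
    using exists_separating_functionals[OF m n, of K s] by blast
  have L0: "L i (\<lambda>t. 0) = 0" for i
    using integral_linearD[OF L[of i], of "\<lambda>t. 0" "\<lambda>t. 0" 0 0] by simp
  have single: "L i f \<le> (\<integral>t. max 0 (f t) \<partial>m)" if f: "integrable m f" and i: "i < n" for i f
  proof -
    define g where "g = (\<lambda>j. if j = i then f else (\<lambda>t. 0))"
    have g: "integrable m (g j)" for j using f by (simp add: g_def)
    have "L i f = (\<Sum>j<n. L j (g j))"
      using i by (subst sum.remove[of _ i]) (auto simp: g_def L0 intro!: sum.neutral)
    also have "\<dots> \<le> (\<integral>t. pos_max g n t \<partial>m)" by (rule L_le[OF g])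
    also have "\<dots> \<le> (\<integral>t. max 0 (f t) \<partial>m)"
      using f by (intro integral_mono integrable_pos_max g pos_max_le integrable_max) (auto simp: g_def)
    finally show ?thesis .
  qed
  have pos: "0 \<le> L i f" if f: "integrable m f" "\<And>t. 0 \<le> f t" and i: "i < n" for i f
  proof -
    \<comment> \<open>This is \<open>single\<close> for \<open>- f\<close>, whose positive part is
      0; the zero summand fits the form of \<open>integral_linearD\<close>.\<close>
    have "L i (\<lambda>t. (-1) * f t + 0 * f t) \<le> (\<integral>t. max 0 ((-1) * f t + 0 * f t) \<partial>m)"
      using f(1) by (intro single i) simp
    also have "\<dots> = 0" using f(2) by (intro integral_eq_zero_AE) (auto simp: max_def intro!: AE_I2 order_antisym)
    finally show ?thesis using integral_linearD[OF L f(1) f(1), of i "-1" 0] by simp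
  qed
  have le: "L i f \<le> 1 * (\<integral>t. f t \<partial>m)" if f: "integrable m f" "\<And>t. 0 \<le> f t" and i: "i < n" for i f
    using single[OF f(1) i] f(2) by (simp add: max_absorb2)
  define \<mu> where "\<mu> i = complexify m (L i)" for i
  have \<mu>: "\<mu> i \<in> vecs (dual (L1 m))" if "i < n" for i
    unfolding \<mu>_def using pos le that by (intro complexify_in_dual[OF L, of _ 1]) auto
  \<comment> \<open>The multi-norm is over the bidual of \<open>L1\<close>, so its test functionals
    lie in the third dual; \<open>\<mu> i\<close> enters there through the canonical
    embedding.\<close>
  define \<phi> where "\<phi> i = bidual_eval (dual (L1 m)) (\<mu> i)" for i
  have "weak_summing_norm 1 (dual (dual (dual (L1 m)))) n \<phi> \<le> ennreal 1"
    unfolding \<phi>_def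
  proof (rule weak_summing_norm_1_bidual_eval_le[OF seminormed_dual[OF seminormed_L1] \<mu>])
    fix \<zeta> :: "nat \<Rightarrow> complex" assume \<zeta>: "\<And>i. cmod (\<zeta> i) \<le> 1"
    show "nrm (dual (L1 m)) (\<lambda>f. \<Sum>i<n. \<zeta> i * \<mu> i f) \<le> 1"
    proof (rule nrm_dual_le[OF seminormed_L1])
      fix f assume "f \<in> vecs (L1 m)"
      hence f: "integrable m f" by (simp add: vecs_L1)
      have "cmod (\<Sum>i<n. \<zeta> i * \<mu> i f) \<le> (\<Sum>i<n. L i (\<lambda>t. cmod (f t)))"
      proof (rule sum_norm_le)
        fix i assume "i \<in> {..<n}"
        hence i: "i < n" by simp
        have "cmod (\<zeta> i * \<mu> i f) \<le> cmod (\<mu> i f)"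
          using \<zeta>[of i] by (simp add: norm_mult mult_left_le_one_le)
        also have "\<dots> \<le> L i (\<lambda>t. cmod (f t))"
          unfolding \<mu>_def by (intro cmod_complexify_le[OF L _ f] pos i)
        finally show "cmod (\<zeta> i * \<mu> i f) \<le> L i (\<lambda>t. cmod (f t))" .
      qed
      \<comment> \<open>All coordinates carry the same function \<open>cmod f\<close>, so the
        maximum is no larger than that function, whatever \<open>n\<close> is.\<close>
      also have "\<dots> \<le> (\<integral>t. pos_max (\<lambda>i t. cmod (f t)) n t \<partial>m)"
        using f by (intro L_le integrable_norm)
      also have "\<dots> \<le> (\<integral>t. cmod (f t) \<partial>m)"
        using f by (intro integral_mono integrable_pos_max pos_max_le integrable_norm) auto
      finally show "cmod (\<Sum>i<n. \<zeta> i * \<mu> i f) \<le> 1 * nrm (L1 m) f" by (simp add: nrm_L1)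
    qed simp
  qed simp_all
  moreover have "\<phi> i \<in> vecs (dual (dual (dual (L1 m))))" if "i < n" for i
    unfolding \<phi>_def by (intro bidual_eval_in_bidual seminormed_dual seminormed_L1 \<mu> that)
  ultimately have "ennreal ((\<Sum>i<n. cmod (\<phi> i (bidual_action m (s i) \<Lambda>)) powr q) powr (1 / q))
      \<le> weak_multi_norm 1 q (dual (dual (L1 m))) n (\<lambda>i. bidual_action m (s i) \<Lambda>)"
    unfolding weak_multi_norm_def by (intro SUP_upper) simp
  also note C(2)
  finally have norm_le: "(\<Sum>i<n. cmod (\<phi> i (bidual_action m (s i) \<Lambda>)) powr q) powr (1 / q) \<le> C"
    using C(1) by simp
  have \<Lambda>in: "\<Lambda> \<in> vecs (dual (dual (L1 m)))" using \<Lambda> by (simp add: mean_def)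
  \<comment> \<open>Taking adjoints moves the translation by \<open>s i\<close> from
    \<open>\<Lambda>\<close> to the functional and then to its argument.\<close>
  define L' where "L' i f = L i (\<lambda>t. f (- s i + t))" for i f
  have L': "integral_linear m (L' i)" for i
    unfolding integral_linear_def L'_def
    using integral_linearD[OF L] integrable_plus_left_haar[OF m] by blast
  have adj: "adjoint_op (L1 m) (translate (s i)) (\<mu> i) = complexify m (L' i)" for i
  proof
    fix f show "adjoint_op (L1 m) (translate (s i)) (\<mu> i) f = complexify m (L' i) f"
      using integrable_plus_left_haar[OF m, of f "- s i"]
      by (simp add: adjoint_op_def vecs_L1 \<mu>_def complexify_def translate_def L'_def)
  qed
  have L'_pos: "0 \<le> L' i f" and L'_le: "L' i f \<le> 1 * (\<integral>t. f t \<partial>m)"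
    if "integrable m f" "\<And>t. 0 \<le> f t" "i < n" for i f
    using pos[of "\<lambda>t. f (- s i + t)" i] le[of "\<lambda>t. f (- s i + t)" i] that
      integrable_plus_left_haar[OF m that(1)] integral_plus_left_haar[OF m that(1)]
    by (simp_all add: L'_def)
  have L'in: "complexify m (L' i) \<in> vecs (dual (L1 m))" if "i < n" for i
    using L'_pos L'_le that by (intro complexify_in_dual[OF L', of _ 1]) auto
  define a where "a i = cmod (\<Lambda> (complexify m (L' i)))" for i
  have \<phi>_eq: "\<phi> i (bidual_action m (s i) \<Lambda>) = \<Lambda> (complexify m (L' i))" if "i < n" for i
    using bidual_action_in_bidual[OF m \<Lambda>in, of "s i"] \<mu>[OF that]
    by (simp add: \<phi>_def bidual_eval_def bidual_action_def adj[symmetric])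
      (simp add: adjoint_op_def[of "dual (L1 m)"])
  have sum_powr: "(\<Sum>i<n. a i powr q) \<le> C powr q"
  proof -
    have "(\<Sum>i<n. a i powr q) powr (1 / q) \<le> C"
      using norm_le by (simp add: a_def \<phi>_eq)
    hence "((\<Sum>i<n. a i powr q) powr (1 / q)) powr q \<le> C powr q"
      using q by (intro powr_mono2) auto
    thus ?thesis using q by (simp add: powr_powr sum_nonneg)
  qed
  have "0 \<le> real n * M" "0 \<le> M powr (1 - q) * C powr q" using M by simp_all
  hence Kpos: "0 \<le> K" using K by linarith
  define T where "T f = (\<Sum>i<n. L' i f)" for f
  have "integral_linear m T"
    unfolding integral_linear_def T_def using integral_linearD[OF L']
    by (simp add: sum.distrib sum_distrib_left)
  \<comment> \<open>Each of the \<open>n\<close> summands is at most the integral of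
    \<open>f\<close>; the maximum with \<open>K\<close> meets the condition \<open>K \<le> N\<close>
    of \<open>mean_complexify_ge\<close>.\<close>
  moreover have "T f \<le> max (real n) K * (\<integral>t. f t \<partial>m)" if f: "integrable m f" "\<And>t. 0 \<le> f t" for f
  proof -
    have "T f \<le> (\<Sum>i<n. 1 * (\<integral>t. f t \<partial>m))" unfolding T_def using f by (intro sum_mono L'_le) auto
    also have "\<dots> \<le> max (real n) K * (\<integral>t. f t \<partial>m)" using f by (simp add: mult_right_mono)
    finally show ?thesis .
  qed
  moreover have "K * (\<integral>t. f t \<partial>m) \<le> T f" if "integrable m f" "\<And>t. 0 \<le> f t" for f
    using L_ge[OF that] by (simp add: T_def L'_def)
  ultimately have "K \<le> Re (\<Lambda> (complexify m T))"
    using Kpos by (intro mean_complexify_ge[OF \<Lambda>, of T K "max (real n) K"]) auto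
  also have "complexify m T = (\<lambda>f. \<Sum>i<n. 1 * complexify m (L' i) f)"
    by (auto simp: complexify_def T_def fun_eq_iff complex_eq_iff)
  also have "\<Lambda> \<dots> = (\<Sum>i<n. 1 * \<Lambda> (complexify m (L' i)))"
    by (rule dual_sum[OF seminormed_dual[OF seminormed_L1] \<Lambda>in L'in])
  also have "Re \<dots> \<le> (\<Sum>i<n. a i)"
    unfolding a_def by (simp add: sum_mono complex_Re_le_cmod)
  also have "\<dots> \<le> (\<Sum>i<n. M + M powr (1 - q) * a i powr q)"
    using M q by (intro sum_mono le_add_powr) (auto simp: a_def)
  also have "\<dots> \<le> real n * M + M powr (1 - q) * C powr q"
    using sum_powr by (simp add: sum.distrib sum_distrib_left[symmetric] mult_left_mono)
  finally show False using K by simp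
qed

text \<open>If all levels satisfied the opposite inequality,
  \<open>nn_integral_le_by_level_sets\<close> would contradict \<open>less\<close>. So one level
  fails it, and the superlevel set of the maximum is there the union of the translates of
  \<open>A\<close>.\<close>

lemma exists_level_set:
  fixes m :: "'g::{topological_group_add,t2_space} measure" and s :: "nat \<Rightarrow> 'g"
  assumes m: "left_haar_measure m" and f: "integrable m f" "\<And>t. 0 \<le> f t" and K: "0 < K"
    and less: "(\<integral>t. pos_max (\<lambda>i t. f (- s i + t)) n t \<partial>m) < K * (\<integral>t. f t \<partial>m)"
  obtains A where "A \<in> sets borel" "0 < emeasure m A" "emeasure m A < \<infinity>"
    "emeasure m (\<Union>x\<in>s ` {..<n}. (\<lambda>t. x + t) ` A) \<le> ennreal K * emeasure m A"
proof -
  let ?g = "pos_max (\<lambda>i t. f (- s i + t)) n"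
  have g: "integrable m ?g"
    by (intro integrable_pos_max integrable_plus_left_haar[OF m f(1)])
  have "ennreal K * (\<integral>\<^sup>+t. ennreal (f t) \<partial>m) = ennreal (K * (\<integral>t. f t \<partial>m))"
    using f K by (simp add: nn_integral_eq_integral ennreal_mult)
  moreover have "(\<integral>\<^sup>+t. ennreal (?g t) \<partial>m) = ennreal (\<integral>t. ?g t \<partial>m)"
    using g by (intro nn_integral_eq_integral) (auto simp: pos_max_nonneg)
  ultimately have "\<not> ennreal K * (\<integral>\<^sup>+t. ennreal (f t) \<partial>m) \<le> (\<integral>\<^sup>+t. ennreal (?g t) \<partial>m)"
    using less f(2) K by (simp add: not_le ennreal_less_iff pos_max_nonneg)
  moreover have "f \<in> borel_measurable m" "?g \<in> borel_measurable m"
    using borel_measurable_integrable[OF f(1)] borel_measurable_integrable[OF g] .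
  note level = nn_integral_le_by_level_sets[OF this f(2) pos_max_nonneg, of "ennreal K"]
  ultimately obtain c where c: "0 < c"
    "\<not> ennreal K * emeasure m {t\<in>space m. c < f t} \<le> emeasure m {t\<in>space m. c < ?g t}"
    using level by fast
  define A where "A = {t. c < f t}"
  have spA: "{t\<in>space m. c < f t} = A"
    using left_haar_measure_space[OF m] by (auto simp: A_def)
  have Am: "A \<in> sets m"
    unfolding spA[symmetric] using f(1) by measurable
  \<comment> \<open>As \<open>c\<close> is positive, the entry 0 of the maximum never exceeds
    it.\<close>
  have "{t\<in>space m. c < ?g t} = {t. \<exists>i<n. c < f (- s i + t)}"
    using c(1) by (simp add: left_haar_measure_space[OF m] less_pos_max_iff)
  also have "\<dots> = (\<Union>x\<in>s ` {..<n}. (\<lambda>t. x + t) ` A)"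
    unfolding image_plus_eq_vimage A_def by auto
  finally have "{t\<in>space m. c < ?g t} = (\<Union>x\<in>s ` {..<n}. (\<lambda>t. x + t) ` A)" .
  with c(2) have "emeasure m (\<Union>x\<in>s ` {..<n}. (\<lambda>t. x + t) ` A) < ennreal K * emeasure m A"
    unfolding spA by (simp add: not_le)
  \<comment> \<open>The strict inequality rules out a right-hand side equal to 0.\<close>
  moreover from this have "0 < emeasure m A" by (cases "emeasure m A = 0") (simp_all add: zero_less_iff_neq_zero)
  moreover have "emeasure m A < \<infinity>"
  proof -
    \<comment> \<open>Markov's inequality: \<open>A\<close> has finite measure because
      \<open>f\<close> is integrable and exceeds \<open>c\<close> on it.\<close>
    have "ennreal c * emeasure m A = (\<integral>\<^sup>+t. ennreal c * indicator A t \<partial>m)"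
      using Am by (rule nn_integral_cmult_indicator[symmetric])
    also have "\<dots> \<le> (\<integral>\<^sup>+t. ennreal (f t) \<partial>m)"
      by (intro nn_integral_mono) (auto simp: A_def indicator_def intro!: ennreal_leI)
    also have "\<dots> < \<infinity>" using f by (simp add: nn_integral_eq_integral)
    finally show ?thesis using c(1) by (auto simp: ennreal_mult_less_top)
  qed
  ultimately show thesis
    using Am by (intro that[of A]) (auto simp: left_haar_measure_sets[OF m])
qed

theorem proposition4p8:
  fixes m :: "'g::{topological_group_add,t2_space} measure" and q :: real
  assumes "locally_compact_space (euclidean :: 'g topology)"
    and "left_haar_measure m"
    and "1 < q"
    and "pq_amenable 1 q m"
  shows "\<forall>\<epsilon>>0. \<exists>n0. \<forall>n\<ge>n0. \<forall>F :: 'g set. finite F \<and> card F = n \<longrightarrow>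
           (\<exists>S. compact S \<and> measure m S > 0 \<and>
                measure m {f + s | f s. f \<in> F \<and> s \<in> S} / measure m S \<le> \<epsilon> * real n)"
proof (intro allI impI)
  note m = assms(2) and q = assms(3)
  fix \<epsilon> :: real assume \<epsilon>: "0 < \<epsilon>"
  obtain \<Lambda> where \<Lambda>: "mean m \<Lambda>" and inv: "left_multi_invariant 1 q m \<Lambda>"
    using assms(4) by (auto simp: pq_amenable_def)
  let ?norm = "\<lambda>n (s :: nat \<Rightarrow> 'g). weak_multi_norm 1 q (dual (dual (L1 m))) n (\<lambda>i. bidual_action m (s i) \<Lambda>)"
  \<comment> \<open>Multi-invariance makes the supremum finite, so \<open>enn2real\<close> preserves
    its value.\<close>
  define C where "C = enn2real (SUP n. SUP s. ?norm n s)"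
  have C: "?norm n s \<le> ennreal C" for n s
  proof -
    have "?norm n s \<le> (SUP n. SUP s. ?norm n s)"
      using SUP_upper[of s UNIV "?norm n"] SUP_upper[of n UNIV "\<lambda>n. SUP s. ?norm n s"]
      by (auto intro: order_trans)
    thus ?thesis using inv by (simp add: C_def left_multi_invariant_def)
  qed
  \<comment> \<open>The level set grows by at most \<open>3 * real n * M\<close>, and passing to a
    compact set doubles this; \<open>6 * M = \<epsilon>\<close>.\<close>
  define M where "M = \<epsilon> / 6"
  have M: "0 < M" using \<epsilon> by (simp add: M_def)
  obtain n0 where n0: "M powr (1 - q) * C powr q / M < real n0" using reals_Archimedean2 by blast
  show "\<exists>n0. \<forall>n\<ge>n0. \<forall>F :: 'g set. finite F \<and> card F = n \<longrightarrow>
           (\<exists>S. compact S \<and> measure m S > 0 \<and>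
                measure m {f + s | f s. f \<in> F \<and> s \<in> S} / measure m S \<le> \<epsilon> * real n)"
  \<comment> \<open>The successor ensures that \<open>n\<close> is positive, as the separation
    argument requires.\<close>
  proof (intro exI[of _ "Suc n0"] allI impI)
    fix n and F :: "'g set" assume nn: "Suc n0 \<le> n" and F: "finite F \<and> card F = n"
    obtain s where s: "F = s ` {..<n}"
      using F ex_bij_betw_nat_finite[of F] by (auto simp: bij_betw_def atLeast0LessThan)
    have n: "0 < n" using nn by simp
    have "M powr (1 - q) * C powr q < real n0 * M" using n0 M by (simp add: field_simps)
    also have "\<dots> \<le> real n * M" using nn M by simp
    finally have "M powr (1 - q) * C powr q < real n * M" .
    moreover have "0 < real n * M" using n M by simp
    \<comment> \<open>The constant term is below one \<open>real n * M\<close>, so the factor 3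
      leaves the strict inequality asked of \<open>K\<close>.\<close>
    ultimately have less: "real n * M + M powr (1 - q) * C powr q < 3 * real n * M" by linarith
    obtain f where f: "integrable m f" "\<And>t. 0 \<le> f t"
      "(\<integral>t. pos_max (\<lambda>i t. f (- s i + t)) n t \<partial>m) < 3 * real n * M * (\<integral>t. f t \<partial>m)"
      using exists_small_pos_max[OF m q \<Lambda> _ C n M less] by (auto simp: C_def)
    obtain A where "A \<in> sets borel" "0 < emeasure m A" "emeasure m A < \<infinity>"
      "emeasure m (\<Union>x\<in>F. (\<lambda>t. x + t) ` A) \<le> ennreal (3 * real n * M) * emeasure m A"
      using exists_level_set[OF m f(1,2) _ f(3)] n M unfolding s by auto
    from exists_compact_small_growth[OF m _ this(1-3) _ this(4)]
    show "\<exists>S. compact S \<and> measure m S > 0 \<and>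
        measure m {f + s | f s. f \<in> F \<and> s \<in> S} / measure m S \<le> \<epsilon> * real n"
      using F n M by (simp add: M_def mult_ac)
  qed
qed

end
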